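(* Consider the model $Y=R_{\phi_*}[X]+\eta$ described in the context. Suppose that $X$ satisfies (A1)--(A3) and that the noise satisfies (B1). Let the complete orthonormal basis $\{\psi_k\}_{k\ge1}$ of $L^2_\rho([0,1])$ satisfy, for some $\delta\ge0$, a positive constant $C_\delta$ depending only on $\delta$, and some $\widetilde L<\infty$, $$\sup_{k\ge1}\|\psi_k\|_{L^4_\rho}\le\widetilde L,\qquad \sup_{1\le k\le n}\|\psi_k\|_\infty\le C_\delta n^\delta\quad\text{for all } n\ge1.$$ Let $L>0$. If $\beta>\delta+\frac12$, then $$\limsup_{M\to\infty}\ \inf_{\widehat\phi}\ \sup_{\phi_*\in H^\beta_\rho(L)}\mathbb E_{\phi_*}\Big[M^{\frac{2\beta}{2\beta+1}}\|\widehat\phi-\phi_*\|_{L^2_\rho}^2\Big]\le C_{\mathrm{upper}},$$ where $C_{\mathrm{upper}}>0$ is a constant independent of $M$ and the infimum is over all estimators $\widehat\phi=\widehat\phi_M$ inferred from the data $\{(X^m,Y^m)\}_{m=1}^M$.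
   Context: Model. Fix integers $N\ge3$, $d\ge1$. Let $X=(X_1,\dots,X_N)$ with $X_i$ random in $\mathbb R^d$, and let the noise $\eta=(\eta_1,\dots,\eta_N)$, $\eta_i\in\mathbb R^d$, be independent of $X$. For $\phi:\mathbb R^+\to\mathbb R$ let $R_\phi[X]=(R_\phi[X]_1,\dots,R_\phi[X]_N)\in\mathbb R^{Nd}$ with $$R_\phi[X]_i=\frac1{N-1}\sum_{j\ne i}\phi(\|X_i-X_j\|)\frac{X_i-X_j}{\|X_i-X_j\|}.$$ The model is $Y=R_{\phi_*}[X]+\eta$; the data $\{(X^m,Y^m)\}_{m=1}^M$ are i.i.d. samples of $(X,Y)$, and $\mathbb E_{\phi_*}$ is expectation when the true kernel is $\phi_*$. Assumptions on $X$: (A1) $X_1,\dots,X_N$ are exchangeable with finite mean; (A2) for each pair $\{X_i-X_j,X_i-X_{j'}\}$ with $j\ne j'$ and $j,j'\ne i$ there is a $\sigma$-algebra $\mathcal X_i$ such that the pair is conditionally independent given $\mathcal X_i$; (A3) for each such pair the joint probability density function is continuous. Assumption on the noise: (B1) $\eta=(\eta_1,\dots,\eta_N)$ consists of i.i.d. centered entries with finite variance $\sigma_\eta^2$ and bounded fourth moment. Exploration measure: $\rho(A)=\frac1{N(N-1)}\sum_{i=1}^N\sum_{j\ne i}\mathbb P(\|X_i-X_j\|\in A)$, which under (A1) is the law of $\|X_1-X_2\|$; it has a continuous density $\rho'$. It is assumed throughout that $[0,1]\subseteq\operatorname{supp}(\rho')$, and the function space of learning is $L^2_\rho=L^2_\rho([0,1])$,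 with $\langle f,g\rangle_{L^2_\rho}=\int_0^1 fg\,d\rho$ and $\|f\|_{L^p_\rho}^p=\int_0^1|f|^p\,d\rho$; functions on $[0,1]$ are extended by zero when inserted in $R_\phi$. Fractional Sobolev class: for $\beta,L>0$, $H^\beta_\rho(L)=\{\phi=\sum_{k\ge1}\theta_k\psi_k\in L^2_\rho([0,1]):\sum_{k\ge1}k^{2\beta}\theta_k^2\le L^2/\pi^{2\beta}\}$.
   Formalization: (A2) is strengthened: given the σ-algebra, the two differences X_i−X_j and X_i−X_j' must also have the same conditional law. As written, (A2) holds for every X (take the σ-algebra generated by X), and then the kernel need not be identifiable and the claim fails. *)

theory Defs
  imports "HOL-Probability.Probability"
begin

text \<open>
  A configuration of \<open>N = CARD('n)\<close> particles in \<open>\<real>\<^sup>d\<close>, \<open>d = CARD('d)\<close>, has type \<open>(real^'d)^'n\<close>.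
\<close>

definition interaction :: "(real \<Rightarrow> real) \<Rightarrow> (real^'d)^'n \<Rightarrow> (real^'d)^'n" where
  "interaction \<phi> x = (\<chi> i. (1 / (real CARD('n) - 1)) *\<^sub>R
     (\<Sum>j\<in>UNIV - {i}. \<phi> (norm (x $ i - x $ j)) *\<^sub>R ((x $ i - x $ j) /\<^sub>R norm (x $ i - x $ j))))"

definition zero_ext :: "(real \<Rightarrow> real) \<Rightarrow> real \<Rightarrow> real" where
  "zero_ext \<phi> r = (if r \<in> {0..1} then \<phi> r else 0)"

definition model_law ::
  "'w measure \<Rightarrow> ('w \<Rightarrow> (real^'d)^'n) \<Rightarrow> ('w \<Rightarrow> (real^'d)^'n) \<Rightarrow> (real \<Rightarrow> real) \<Rightarrow>
     (((real^'d)^'n) \<times> ((real^'d)^'n)) measure" where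
  "model_law P X \<eta> \<phi> =
     distr P (borel \<Otimes>\<^sub>M borel) (\<lambda>\<omega>. (X \<omega>, interaction (zero_ext \<phi>) (X \<omega>) + \<eta> \<omega>))"

definition data_law ::
  "'w measure \<Rightarrow> ('w \<Rightarrow> (real^'d)^'n) \<Rightarrow> ('w \<Rightarrow> (real^'d)^'n) \<Rightarrow> nat \<Rightarrow> (real \<Rightarrow> real) \<Rightarrow>
     (nat \<Rightarrow> ((real^'d)^'n) \<times> ((real^'d)^'n)) measure" where
  "data_law P X \<eta> M \<phi> = PiM {1..M} (\<lambda>_. model_law P X \<eta> \<phi>)"

definition exchangeable_A1 :: "'w measure \<Rightarrow> ('w \<Rightarrow> (real^'d)^'n) \<Rightarrow> bool" where
  "exchangeable_A1 P X \<longleftrightarrow>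
     (\<forall>\<pi>. bij \<pi> \<longrightarrow> distr P borel (\<lambda>\<omega>. \<chi> i. X \<omega> $ \<pi> i) = distr P borel X) \<and>
     (\<forall>i. integrable P (\<lambda>\<omega>. X \<omega> $ i))"

definition cond_prob :: "'w measure \<Rightarrow> 'w measure \<Rightarrow> 'w set \<Rightarrow> 'w \<Rightarrow> real" where
  "cond_prob P F E = real_cond_exp P F (indicator E)"

definition cond_indep ::
  "'w measure \<Rightarrow> 'w measure \<Rightarrow> ('w \<Rightarrow> 'a::topological_space) \<Rightarrow> ('w \<Rightarrow> 'a) \<Rightarrow> bool" where
  "cond_indep P F U V \<longleftrightarrow> (\<forall>A\<in>sets borel. \<forall>B\<in>sets borel. AE \<omega> in P.
     cond_prob P F {\<omega>\<in>space P. U \<omega> \<in> A \<and> V \<omega> \<in> B} \<omega> =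
     cond_prob P F {\<omega>\<in>space P. U \<omega> \<in> A} \<omega> * cond_prob P F {\<omega>\<in>space P. V \<omega> \<in> B} \<omega>)"

definition cond_same_law ::
  "'w measure \<Rightarrow> 'w measure \<Rightarrow> ('w \<Rightarrow> 'a::topological_space) \<Rightarrow> ('w \<Rightarrow> 'a) \<Rightarrow> bool" where
  "cond_same_law P F U V \<longleftrightarrow> (\<forall>A\<in>sets borel. AE \<omega> in P.
     cond_prob P F {\<omega>\<in>space P. U \<omega> \<in> A} \<omega> = cond_prob P F {\<omega>\<in>space P. V \<omega> \<in> A} \<omega>)"

text \<open>
  The sigma-algebra \<open>F\<close> has to respect the exchangeability of the pair, so that the pair is
  conditionally i.i.d. given \<open>F\<close>, as in de Finetti's theorem. Conditional independence without
  \<^const>\<open>cond_same_law\<close> would be no condition at all (any pair is conditionally independent given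
  the sigma-algebra generated by \<open>X\<close>), and the kernel need not be identifiable without it.
\<close>

definition cond_indep_A2 :: "'w measure \<Rightarrow> ('w \<Rightarrow> (real^'d)^'n) \<Rightarrow> bool" where
  "cond_indep_A2 P X \<longleftrightarrow> (\<forall>i j j'. j \<noteq> j' \<and> j \<noteq> i \<and> j' \<noteq> i \<longrightarrow>
     (\<exists>F. subalgebra P F \<and>
          cond_indep P F (\<lambda>\<omega>. X \<omega> $ i - X \<omega> $ j) (\<lambda>\<omega>. X \<omega> $ i - X \<omega> $ j') \<and>
          cond_same_law P F (\<lambda>\<omega>. X \<omega> $ i - X \<omega> $ j) (\<lambda>\<omega>. X \<omega> $ i - X \<omega> $ j')))"

definition continuous_density_A3 :: "'w measure \<Rightarrow> ('w \<Rightarrow> (real^'d)^'n) \<Rightarrow> bool" where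
  "continuous_density_A3 P X \<longleftrightarrow> (\<forall>i j j'. j \<noteq> j' \<and> j \<noteq> i \<and> j' \<noteq> i \<longrightarrow>
     (\<exists>p :: (real^'d) \<times> (real^'d) \<Rightarrow> real. continuous_on UNIV p \<and> (\<forall>z. 0 \<le> p z) \<and>
        distributed P (lborel \<Otimes>\<^sub>M lborel)
          (\<lambda>\<omega>. (X \<omega> $ i - X \<omega> $ j, X \<omega> $ i - X \<omega> $ j')) (\<lambda>z. ennreal (p z))))"

text \<open>
  The entries are the \<open>\<real>\<^sup>d\<close>-valued vectors \<open>\<eta>\<^sub>i\<close>. Independence between the coordinates of a single
  \<open>\<eta>\<^sub>i\<close> is not required, so noise whose \<open>N d\<close> scalar entries are i.i.d. is a special case.
\<close>

definition noise_B1 :: "'w measure \<Rightarrow> ('w \<Rightarrow> (real^'d)^'n) \<Rightarrow> real \<Rightarrow> bool" where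
  "noise_B1 P \<eta> \<sigma> \<longleftrightarrow>
     prob_space.indep_vars P (\<lambda>_. borel) (\<lambda>i \<omega>. \<eta> \<omega> $ i) UNIV \<and>
     (\<forall>i j. distr P borel (\<lambda>\<omega>. \<eta> \<omega> $ i) = distr P borel (\<lambda>\<omega>. \<eta> \<omega> $ j)) \<and>
     (\<forall>i. integrable P (\<lambda>\<omega>. \<eta> \<omega> $ i) \<and> (LINT \<omega>|P. \<eta> \<omega> $ i) = 0) \<and>
     (\<forall>i. integrable P (\<lambda>\<omega>. norm (\<eta> \<omega> $ i) ^ 2) \<and> (LINT \<omega>|P. norm (\<eta> \<omega> $ i) ^ 2) = \<sigma>\<^sup>2) \<and>
     (\<forall>i. integrable P (\<lambda>\<omega>. norm (\<eta> \<omega> $ i) ^ 4))"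

definition exploration :: "'w measure \<Rightarrow> ('w \<Rightarrow> (real^'d)^'n) \<Rightarrow> real measure" where
  "exploration P X = measure_of UNIV (sets borel) (\<lambda>A. ennreal
     (1 / (real CARD('n) * (real CARD('n) - 1)) *
      (\<Sum>i\<in>UNIV. \<Sum>j\<in>UNIV - {i}. measure P {\<omega>\<in>space P. norm (X \<omega> $ i - X \<omega> $ j) \<in> A})))"

lemma space_exploration [simp]: "space (exploration P X) = UNIV"
  by (simp add: exploration_def space_measure_of_conv)

lemma sets_exploration [simp, measurable_cong]: "sets (exploration P X) = sets borel"
  by (simp add: exploration_def sets.sigma_sets_eq[of borel, simplified])

lemma emeasure_exploration:
  fixes X :: "'w \<Rightarrow> (real^'d)^'n"
  assumes "prob_space P" and X: "X \<in> borel_measurable P" and A: "A \<in> sets borel"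
  shows "emeasure (exploration P X) A = ennreal
     (1 / (real CARD('n) * (real CARD('n) - 1)) *
      (\<Sum>i\<in>UNIV. \<Sum>j\<in>UNIV - {i}. measure P {\<omega>\<in>space P. norm (X \<omega> $ i - X \<omega> $ j) \<in> A}))"
    (is "_ = ?\<mu> A")
proof -
  interpret prob_space P by fact
  define c where "c = 1 / (real CARD('n) * (real CARD('n) - 1))"
  have "CARD('n) \<ge> 1" by (simp add: Suc_leI)
  then have c: "c \<ge> 0" unfolding c_def by simp
  define E where "E i j A = {\<omega>\<in>space P. norm (X \<omega> $ i - X \<omega> $ j) \<in> A}" for i j A
  have [measurable]: "(\<lambda>\<omega>. X \<omega> $ i) \<in> borel_measurable P" for i
    using X by (rule measurable_compose) (intro borel_measurable_continuous_onI continuous_intros)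
  have E: "E i j A \<in> sets P" if [measurable]: "A \<in> sets borel" for i j A
    unfolding E_def by measurable
  have eq: "?\<mu> A = (\<Sum>i\<in>UNIV. \<Sum>j\<in>UNIV - {i}. ennreal c * emeasure P (E i j A))" for A
  proof -
    have "?\<mu> A = ennreal (\<Sum>i\<in>UNIV. \<Sum>j\<in>UNIV - {i}. c * measure P (E i j A))"
      by (simp add: c_def E_def sum_distrib_left)
    also have "\<dots> = (\<Sum>i\<in>UNIV. ennreal (\<Sum>j\<in>UNIV - {i}. c * measure P (E i j A)))"
      by (rule sum_ennreal[symmetric]) (auto intro!: sum_nonneg mult_nonneg_nonneg c)
    also have "\<dots> = (\<Sum>i\<in>UNIV. \<Sum>j\<in>UNIV - {i}. ennreal (c * measure P (E i j A)))"
      by (intro sum.cong refl sum_ennreal[symmetric] mult_nonneg_nonneg c measure_nonneg)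
    also have "\<dots> = (\<Sum>i\<in>UNIV. \<Sum>j\<in>UNIV - {i}. ennreal c * emeasure P (E i j A))"
      by (simp add: ennreal_mult c emeasure_eq_measure)
    finally show ?thesis .
  qed
  show ?thesis
  proof (rule emeasure_measure_of[OF exploration_def])
    show "A \<in> sets (exploration P X)" using A by simp
    show "positive (sets (exploration P X)) ?\<mu>"
      by (simp add: positive_def)
    show "countably_additive (sets (exploration P X)) ?\<mu>"
    proof (rule countably_additiveI)
      fix B :: "nat \<Rightarrow> real set"
      assume B: "range B \<subseteq> sets (exploration P X)" "disjoint_family B"
      have "(\<Sum>k. emeasure P (E i j (B k))) = emeasure P (E i j (\<Union>k. B k))" for i j
      proof -
        have "(\<Union>k. E i j (B k)) = E i j (\<Union>k. B k)" by (auto simp: E_def)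
        moreover have "(\<Sum>k. emeasure P (E i j (B k))) = emeasure P (\<Union>k. E i j (B k))"
          using B E by (intro suminf_emeasure) (auto simp: disjoint_family_on_def E_def)
        ultimately show ?thesis by simp
      qed
      then show "(\<Sum>k. ?\<mu> (B k)) = ?\<mu> (\<Union>k. B k)"
        unfolding eq by (subst suminf_sum, simp)+ simp
    qed
  qed auto
qed

text \<open>
  Distances take values in \<open>{0..}\<close>, so the density \<open>\<rho>'\<close> is a function there; in dimension one it need
  not tend to \<open>0\<close> at \<open>0\<close>, and its extension by zero is in general not continuous on the whole line.
\<close>

definition has_continuous_density :: "real measure \<Rightarrow> (real \<Rightarrow> real) \<Rightarrow> bool" where
  "has_continuous_density \<rho> \<rho>' \<longleftrightarrow>
     continuous_on {0..} \<rho>' \<and> (\<forall>r\<ge>0. 0 \<le> \<rho>' r) \<and>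
     \<rho> = density lborel (\<lambda>r. ennreal (indicator {0..} r * \<rho>' r))"

definition supp :: "(real \<Rightarrow> real) \<Rightarrow> real set" where
  "supp \<rho>' = closure {r\<in>{0..}. \<rho>' r \<noteq> 0}"

definition on_unit :: "real measure \<Rightarrow> real measure" where
  "on_unit \<rho> = restrict_space \<rho> {0..1}"

definition Lp :: "'a measure \<Rightarrow> nat \<Rightarrow> ('a \<Rightarrow> real) set" where
  "Lp \<mu> p = {f \<in> borel_measurable \<mu>. integrable \<mu> (\<lambda>r. \<bar>f r\<bar> ^ p)}"

definition Lp_norm :: "'a measure \<Rightarrow> nat \<Rightarrow> ('a \<Rightarrow> real) \<Rightarrow> real" where
  "Lp_norm \<mu> p f = root p (LINT r|\<mu>. \<bar>f r\<bar> ^ p)"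

definition L2_inner :: "'a measure \<Rightarrow> ('a \<Rightarrow> real) \<Rightarrow> ('a \<Rightarrow> real) \<Rightarrow> real" where
  "L2_inner \<mu> f g = (LINT r|\<mu>. f r * g r)"

definition Linf_norm :: "'a measure \<Rightarrow> ('a \<Rightarrow> real) \<Rightarrow> ereal" where
  "Linf_norm \<mu> f = esssup \<mu> (\<lambda>r. ereal \<bar>f r\<bar>)"

text \<open>Basis functions and coefficients are indexed by \<open>k \<ge> 1\<close>; the value at index \<open>0\<close> is never used.\<close>

definition L2_expansion :: "'a measure \<Rightarrow> (nat \<Rightarrow> 'a \<Rightarrow> real) \<Rightarrow> (nat \<Rightarrow> real) \<Rightarrow> ('a \<Rightarrow> real) \<Rightarrow> bool" where
  "L2_expansion \<mu> \<psi> \<theta> f \<longleftrightarrow>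
     (\<lambda>n. Lp_norm \<mu> 2 (\<lambda>r. f r - (\<Sum>k=1..n. \<theta> k * \<psi> k r))) \<longlonglongrightarrow> 0"

definition complete_orthonormal_basis :: "'a measure \<Rightarrow> (nat \<Rightarrow> 'a \<Rightarrow> real) \<Rightarrow> bool" where
  "complete_orthonormal_basis \<mu> \<psi> \<longleftrightarrow>
     (\<forall>k\<ge>1. \<psi> k \<in> Lp \<mu> 2) \<and>
     (\<forall>k\<ge>1. \<forall>l\<ge>1. L2_inner \<mu> (\<psi> k) (\<psi> l) = (if k = l then 1 else 0)) \<and>
     (\<forall>f\<in>Lp \<mu> 2. L2_expansion \<mu> \<psi> (\<lambda>k. L2_inner \<mu> f (\<psi> k)) f)"

definition sobolev_class :: "'a measure \<Rightarrow> (nat \<Rightarrow> 'a \<Rightarrow> real) \<Rightarrow> real \<Rightarrow> real \<Rightarrow> ('a \<Rightarrow> real) set" where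
  "sobolev_class \<mu> \<psi> \<beta> L = {\<phi> \<in> Lp \<mu> 2. \<exists>\<theta>. L2_expansion \<mu> \<psi> \<theta> \<phi> \<and>
     (\<lambda>k. real k powr (2 * \<beta>) * (\<theta> k)\<^sup>2) summable_on {1..} \<and>
     (\<Sum>\<^sub>\<infinity>k\<in>{1..}. real k powr (2 * \<beta>) * (\<theta> k)\<^sup>2) \<le> L\<^sup>2 / pi powr (2 * \<beta>)}"

text \<open>
  An estimator is an \<open>L\<^sup>2\<close>-valued measurable function of the data, given as a jointly measurable
  function of the data and the argument of the kernel.
\<close>

definition estimators ::
  "real measure \<Rightarrow> nat \<Rightarrow> ((nat \<Rightarrow> ((real^'d)^'n) \<times> ((real^'d)^'n)) \<Rightarrow> real \<Rightarrow> real) set" where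
  "estimators \<mu> M = {est.
     (\<lambda>(D, r). est D r) \<in> borel_measurable (PiM {1..M} (\<lambda>_. borel \<Otimes>\<^sub>M borel) \<Otimes>\<^sub>M \<mu>) \<and>
     (\<forall>D \<in> space (PiM {1..M} (\<lambda>_. borel \<Otimes>\<^sub>M borel)). est D \<in> Lp \<mu> 2)}"

definition scaled_risk ::
  "'w measure \<Rightarrow> ('w \<Rightarrow> (real^'d)^'n) \<Rightarrow> ('w \<Rightarrow> (real^'d)^'n) \<Rightarrow> real measure \<Rightarrow> real \<Rightarrow> nat \<Rightarrow>
     ((nat \<Rightarrow> ((real^'d)^'n) \<times> ((real^'d)^'n)) \<Rightarrow> real \<Rightarrow> real) \<Rightarrow> (real \<Rightarrow> real) \<Rightarrow> ennreal" where
  "scaled_risk P X \<eta> \<mu> \<beta> M est \<phi> =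
     (\<integral>\<^sup>+D. ennreal (real M powr (2 * \<beta> / (2 * \<beta> + 1)) * (Lp_norm \<mu> 2 (\<lambda>r. est D r - \<phi> r))\<^sup>2)
        \<partial>data_law P X \<eta> M \<phi>)"

end

theory Submission
  imports Defs
begin

text \<open>
  Write \<open>R\<^sub>f\<close> for the interaction field of the zero extension of \<open>f\<close>. The bilinear form
  \<open>a(f, g) = E (R\<^sub>f(X) \<bullet> R\<^sub>g(X))\<close> on \<open>L\<^sup>2(\<mu>)\<close> is known to the statistician: the supremum is over the
  kernel only, so an estimator may depend on the law of \<open>X\<close>. The data give unbiased access to this
  form, because \<open>E (R\<^sub>f(X) \<bullet> Y) = a(f, \<phi>)\<close> when \<open>\<phi>\<close> is the true kernel and the noise is centred and
  independent of \<open>X\<close>.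

  The form is equivalent to the squared norm of \<open>L\<^sup>2(\<mu>)\<close>. The upper bound \<open>a(f, f) \<le> N \<parallel>f\<parallel>\<^sup>2\<close> is
  convexity (\<open>force_bounded\<close>). The lower bound \<open>a(f, f) \<ge> N / (N - 1) \<parallel>f\<parallel>\<^sup>2\<close> is the identifiability
  of the kernel (\<open>force_coercive\<close>): expanding the square of the field at a particle, the diagonal
  terms add up to the norm of \<open>f\<close>, and an off-diagonal term is nonnegative, since for a conditionally
  i.i.d. pair \<open>U, V\<close> the expectation of \<open>g(U) g(V)\<close> equals that of the square of the conditional
  expectation of \<open>g(U)\<close> (\<open>conditionally_iid_product_nonneg\<close>).

  Hence \<open>\<psi>\<^sub>1, \<dots>, \<psi>\<^sub>n\<close> can be orthonormalised with respect to \<open>a\<close> to functions \<open>e\<^sub>1, \<dots>, e\<^sub>n\<close> with the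
  same span (\<open>orthonormal_forces_exist\<close>), and the estimator is \<open>\<Sum>k\<le>n. c\<^sub>k e\<^sub>k\<close> with \<open>c\<^sub>k\<close> the sample
  mean of \<open>R\<^bsub>e\<^sub>k\<^esub>(X) \<bullet> Y\<close>. By Pythagoras its squared \<open>a\<close>-distance to \<open>\<phi>\<close> is the sum of the squared errors
  of the \<open>c\<^sub>k\<close> and of the squared \<open>a\<close>-distance of \<open>\<phi>\<close> to the span (\<open>projection_error\<close>).

  Each \<open>c\<^sub>k\<close> has variance \<open>O(1/M)\<close>, uniformly in \<open>k\<close> and in the kernel: \<open>a(e\<^sub>k, e\<^sub>k) = 1\<close>, and \<open>\<beta> > \<delta> + 1/2\<close>
  makes the expansions of the Sobolev class converge uniformly, so that its members share a sup bound
  (\<open>sobolev_sup_bound\<close>). The distance to the span is at most of the order of the tail of the basis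
  expansion, \<open>n powr (- 2 * \<beta>)\<close> (\<open>sobolev_tail_bound\<close>). The choice \<open>n \<approx> M powr (1 / (2 * \<beta> + 1))\<close> balances
  \<open>n / M\<close> against \<open>n powr (- 2 * \<beta>)\<close> and gives the rate.
\<close>

section \<open>Orthonormalisation and best approximation in mean square\<close>

text \<open>
  Gram--Schmidt for a positive definite array. Working with coefficients yields an orthonormal family
  of genuine linear combinations of given functions, with equality everywhere and not only almost
  everywhere.
\<close>

lemma gram_schmidt_coefficients:
  fixes A :: "'k \<Rightarrow> 'k \<Rightarrow> real"
  assumes "finite T" and sym: "\<And>p q. A p q = A q p"
    and pos: "\<And>x. \<exists>k\<in>T. x k \<noteq> 0 \<Longrightarrow> 0 < (\<Sum>p\<in>T. \<Sum>q\<in>T. x p * x q * A p q)"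
  shows "\<exists>G. (\<forall>k\<in>T. \<forall>l\<in>T. (\<Sum>p\<in>T. \<Sum>q\<in>T. G k p * G l q * A p q) = (if k = l then 1 else 0)) \<and>
             (\<forall>x. \<exists>y. \<forall>p\<in>T. x p = (\<Sum>k\<in>T. y k * G k p))"
proof -
  define B where "B x y = (\<Sum>p\<in>T. \<Sum>q\<in>T. x p * y q * A p q)" for x y :: "'k \<Rightarrow> real"
  have B_commute: "B x y = B y x" for x y
    unfolding B_def by (subst sum.swap) (simp add: sym mult.commute mult.left_commute)
  have B_diff: "B x (\<lambda>p. y p - w p) = B x y - B x w" for x y w
    unfolding B_def by (simp add: algebra_simps sum_subtractf)
  have B_scale: "B x (\<lambda>p. c * y p) = c * B x y" for c x y
    unfolding B_def by (simp add: sum_distrib_left mult_ac)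
  have B_scale_left: "B (\<lambda>p. c * y p) x = c * B y x" for c x y
    by (simp only: B_commute[of _ x] B_scale)
  have B_sum: "B x (\<lambda>p. \<Sum>k\<in>K. y k p) = (\<Sum>k\<in>K. B x (y k))" for x K and y :: "'k \<Rightarrow> 'k \<Rightarrow> real"
  proof -
    have "B x (\<lambda>p. \<Sum>k\<in>K. y k p) = (\<Sum>p\<in>T. \<Sum>q\<in>T. \<Sum>k\<in>K. x p * y k q * A p q)"
      unfolding B_def by (simp add: sum_distrib_left sum_distrib_right)
    also have "\<dots> = (\<Sum>p\<in>T. \<Sum>k\<in>K. \<Sum>q\<in>T. x p * y k q * A p q)"
      by (intro sum.cong refl sum.swap)
    also have "\<dots> = (\<Sum>k\<in>K. B x (y k))"
      unfolding B_def by (rule sum.swap)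
    finally show ?thesis .
  qed
  have "\<exists>G. (\<forall>k\<in>S. \<forall>p. p \<notin> S \<longrightarrow> G k p = 0) \<and>
            (\<forall>k\<in>S. \<forall>l\<in>S. B (G k) (G l) = (if k = l then 1 else 0)) \<and>
            (\<forall>x. (\<forall>p. p \<notin> S \<longrightarrow> x p = 0) \<longrightarrow> (\<exists>y. \<forall>p. x p = (\<Sum>k\<in>S. y k * G k p)))"
    if "finite S" "S \<subseteq> T" for S
    using that
  proof (induction S)
    case empty
    then show ?case by auto
  next
    case (insert z S)
    then have "S \<subseteq> T" by simp
    from insert.IH[OF this] obtain G where supp: "\<forall>k\<in>S. \<forall>p. p \<notin> S \<longrightarrow> G k p = 0"
      and orth: "\<forall>k\<in>S. \<forall>l\<in>S. B (G k) (G l) = (if k = l then 1 else 0)"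
      and span: "\<forall>x. (\<forall>p. p \<notin> S \<longrightarrow> x p = 0) \<longrightarrow> (\<exists>y. \<forall>p. x p = (\<Sum>k\<in>S. y k * G k p))"
      by (elim exE conjE) (rule that)
    \<comment> \<open>\<open>v\<close> is the unit vector at the new index \<open>z\<close> minus its projection to the span so far; its entry at
      \<open>z\<close> is \<open>1\<close>, so it is nonzero and can be normalised.\<close>
    define u where "u p = (if p = z then 1 else 0 :: real)" for p
    define v where "v p = u p - (\<Sum>k\<in>S. B (G k) u * G k p)" for p
    have v_supp: "v p = 0" if "p \<notin> insert z S" for p
      using that supp by (simp add: v_def u_def)
    have v_z: "v z = 1"
      using supp insert.hyps by (simp add: v_def u_def)
    have orth_v: "B (G k) v = 0" if "k \<in> S" for k
    proof -
      have "B (G k) v = B (G k) u - (\<Sum>l\<in>S. B (G l) u * B (G k) (G l))"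
        unfolding v_def B_diff B_sum B_scale ..
      also have "(\<Sum>l\<in>S. B (G l) u * B (G k) (G l)) = (\<Sum>l\<in>S. if k = l then B (G l) u else 0)"
        using that by (intro sum.cong) (auto simp: orth)
      finally show ?thesis using that insert.hyps by simp
    qed
    have "0 < B v v"
      unfolding B_def using insert.prems v_z by (intro pos bexI[of _ z]) auto
    define s where "s = sqrt (B v v)"
    have s: "s > 0" "s * s = B v v"
      using \<open>0 < B v v\<close> by (auto simp: s_def)
    define H where "H k = (if k = z then (\<lambda>p. (1 / s) * v p) else G k)" for k
    have H_S: "H k = G k" if "k \<in> S" for k
      using that insert.hyps by (auto simp: H_def)
    have H_z: "H z = (\<lambda>p. (1 / s) * v p)" by (simp add: H_def)
    have Hzz: "B (H z) (H z) = 1"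
      unfolding H_z B_scale B_scale_left using s \<open>0 < B v v\<close> by (simp add: field_simps)
    have Hkz: "B (H k) (H z) = 0" if "k \<in> S" for k
      unfolding H_S[OF that] H_z B_scale by (simp add: orth_v that)
    have Hzk: "B (H z) (H k) = 0" if "k \<in> S" for k
      using Hkz[OF that] by (simp only: B_commute[of "H z" "H k"])
    have "\<forall>k\<in>insert z S. \<forall>p. p \<notin> insert z S \<longrightarrow> H k p = 0"
      using supp v_supp by (auto simp: H_def)
    moreover have "\<forall>k\<in>insert z S. \<forall>l\<in>insert z S. B (H k) (H l) = (if k = l then 1 else 0)"
      using Hzz Hkz Hzk insert.hyps(2) by (auto simp: H_S orth)
    moreover have "\<exists>y. \<forall>p. x p = (\<Sum>k\<in>insert z S. y k * H k p)"
      if x: "\<forall>p. p \<notin> insert z S \<longrightarrow> x p = 0" for x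
    proof -
      obtain y where y: "\<And>p. x p - x z * v p = (\<Sum>k\<in>S. y k * G k p)"
        using span[rule_format, of "\<lambda>p. x p - x z * v p"] x v_supp v_z
        by (metis diff_0_right insert_iff mult.right_neutral mult_zero_right right_minus_eq)
      have "x p = (\<Sum>k\<in>insert z S. (y(z := x z * s)) k * H k p)" for p
      proof -
        have "(\<Sum>k\<in>S. (y(z := x z * s)) k * H k p) = (\<Sum>k\<in>S. y k * G k p)"
          using insert.hyps by (intro sum.cong) (auto simp: H_S)
        then show ?thesis
          using insert.hyps y[of p] s by (simp add: H_z)
      qed
      then show ?thesis by blast
    qed
    ultimately show ?case by blast
  qed
  from this[OF \<open>finite T\<close> order_refl] obtain G
    where orth: "\<forall>k\<in>T. \<forall>l\<in>T. B (G k) (G l) = (if k = l then 1 else 0)"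
      and span: "\<And>x. (\<forall>p. p \<notin> T \<longrightarrow> x p = 0) \<Longrightarrow> \<exists>y. \<forall>p. x p = (\<Sum>k\<in>T. y k * G k p)"
    by auto
  have "\<exists>y. \<forall>p\<in>T. x p = (\<Sum>k\<in>T. y k * G k p)" for x
  proof -
    obtain y where y: "\<forall>p. (if p \<in> T then x p else 0) = (\<Sum>k\<in>T. y k * G k p)"
      using span[of "\<lambda>p. if p \<in> T then x p else 0"] by auto
    show ?thesis by (intro exI[of _ y] ballI) (use y in \<open>auto split: if_splits\<close>)
  qed
  with orth show ?thesis unfolding B_def by (intro exI[of _ G]) simp
qed

definition square_integrable :: "'a measure \<Rightarrow> ('a \<Rightarrow> 'b::euclidean_space) set" where
  "square_integrable M = {f \<in> borel_measurable M. integrable M (\<lambda>x. (norm (f x))\<^sup>2)}"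

lemma square_integrableD:
  assumes "f \<in> square_integrable M"
  shows "f \<in> borel_measurable M" "integrable M (\<lambda>x. (norm (f x))\<^sup>2)"
  using assms by (auto simp: square_integrable_def)

lemma Lp_2_eq_square_integrable: "Lp M 2 = square_integrable M"
  by (simp add: Lp_def square_integrable_def)

lemma square_integrable_inner:
  assumes "f \<in> square_integrable M" "g \<in> square_integrable M"
  shows "integrable M (\<lambda>x. f x \<bullet> g x)"
proof (rule Bochner_Integration.integrable_bound)
  note [measurable] = square_integrableD(1)[OF assms(1)] square_integrableD(1)[OF assms(2)]
  show "integrable M (\<lambda>x. (norm (f x))\<^sup>2 + (norm (g x))\<^sup>2)"
    using assms by (auto dest: square_integrableD)
  show "(\<lambda>x. f x \<bullet> g x) \<in> borel_measurable M" by measurable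
  show "AE x in M. norm (f x \<bullet> g x) \<le> norm ((norm (f x))\<^sup>2 + (norm (g x))\<^sup>2)"
  proof (rule AE_I2)
    fix x
    have "\<bar>f x \<bullet> g x\<bar> \<le> norm (f x) * norm (g x)" by (rule Cauchy_Schwarz_ineq2)
    moreover have "0 \<le> (norm (f x) - norm (g x))\<^sup>2" by simp
    ultimately show "norm (f x \<bullet> g x) \<le> norm ((norm (f x))\<^sup>2 + (norm (g x))\<^sup>2)"
      by (simp add: power2_diff)
  qed
qed

lemma square_integrable_scaleR:
  assumes "f \<in> square_integrable M"
  shows "(\<lambda>x. c *\<^sub>R f x) \<in> square_integrable M"
  using square_integrableD[OF assms]
  by (auto simp: square_integrable_def power_mult_distrib)

lemma square_integrable_add:
  assumes "f \<in> square_integrable M" "g \<in> square_integrable M"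
  shows "(\<lambda>x. f x + g x) \<in> square_integrable M"
proof -
  note [measurable] = square_integrableD(1)[OF assms(1)] square_integrableD(1)[OF assms(2)]
  have "integrable M (\<lambda>x. (norm (f x))\<^sup>2 + (norm (g x))\<^sup>2 + 2 * (f x \<bullet> g x))"
    using square_integrableD(2)[OF assms(1)] square_integrableD(2)[OF assms(2)]
      square_integrable_inner[OF assms] by auto
  then show ?thesis
    by (auto simp: square_integrable_def power2_norm_eq_inner algebra_simps inner_commute)
qed

lemma square_integrable_sum:
  assumes "\<And>k. k \<in> K \<Longrightarrow> f k \<in> square_integrable M"
  shows "(\<lambda>x. \<Sum>k\<in>K. f k x) \<in> square_integrable M"
  using assms
proof (induction K rule: infinite_finite_induct)
  case (insert k K)
  then show ?case using square_integrable_add[of "f k" M "\<lambda>x. \<Sum>k\<in>K. f k x"] by simp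
qed (auto simp: square_integrable_def)

lemma square_integrable_diff:
  assumes "f \<in> square_integrable M" "g \<in> square_integrable M"
  shows "(\<lambda>x. f x - g x) \<in> square_integrable M"
  using square_integrable_add[OF assms(1) square_integrable_scaleR[OF assms(2), of "-1"]] by simp

lemma integral_norm_sum_squared:
  assumes "\<And>k. k \<in> K \<Longrightarrow> V k \<in> square_integrable M"
  shows "(LINT x|M. (norm (\<Sum>k\<in>K. c k *\<^sub>R V k x))\<^sup>2) =
    (\<Sum>p\<in>K. \<Sum>q\<in>K. c p * c q * (LINT x|M. V p x \<bullet> V q x))"
proof -
  have "(LINT x|M. (norm (\<Sum>k\<in>K. c k *\<^sub>R V k x))\<^sup>2)
      = (LINT x|M. (\<Sum>p\<in>K. \<Sum>q\<in>K. c p * c q * (V p x \<bullet> V q x)))"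
    by (intro Bochner_Integration.integral_cong refl)
      (simp add: power2_norm_eq_inner inner_sum_left inner_sum_right sum_distrib_left mult_ac,
       subst sum.swap, simp add: mult_ac)
  also have "\<dots> = (\<Sum>p\<in>K. \<Sum>q\<in>K. c p * c q * (LINT x|M. V p x \<bullet> V q x))"
    using assms by (simp add: square_integrable_inner integral_sum)
  finally show ?thesis .
qed

text \<open>
  Pythagoras in \<open>L\<^sup>2\<close>. The last summand, which does not depend on \<open>y\<close>, is the squared distance of \<open>W\<close> to
  the span of the \<open>V k\<close>; so the error of one combination controls the part of the error of any other
  one that is due to \<open>W\<close> lying off the span.
\<close>

lemma orthonormal_expansion_error:
  fixes V :: "'k \<Rightarrow> 'a \<Rightarrow> 'b::euclidean_space"
  assumes K: "finite K" and V: "\<And>k. k \<in> K \<Longrightarrow> V k \<in> square_integrable M"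
    and orth: "\<And>k l. k \<in> K \<Longrightarrow> l \<in> K \<Longrightarrow> (LINT x|M. V k x \<bullet> V l x) = (if k = l then 1 else 0)"
    and W: "W \<in> square_integrable M"
  defines "c \<equiv> \<lambda>k. LINT x|M. V k x \<bullet> W x"
  shows "(LINT x|M. (norm ((\<Sum>k\<in>K. y k *\<^sub>R V k x) - W x))\<^sup>2) =
    (\<Sum>k\<in>K. (y k - c k)\<^sup>2) + ((LINT x|M. (norm (W x))\<^sup>2) - (\<Sum>k\<in>K. (c k)\<^sup>2))"
proof -
  have S: "(\<lambda>x. \<Sum>k\<in>K. y k *\<^sub>R V k x) \<in> square_integrable M"
    using V by (intro square_integrable_sum square_integrable_scaleR)
  have "(\<Sum>p\<in>K. \<Sum>q\<in>K. y p * y q * (LINT x|M. V p x \<bullet> V q x)) = (\<Sum>p\<in>K. \<Sum>q\<in>K. if p = q then y p * y p else 0)"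
    by (intro sum.cong refl) (simp add: orth)
  also have "\<dots> = (\<Sum>k\<in>K. (y k)\<^sup>2)"
    using K by (simp add: power2_eq_square)
  finally have sq: "(LINT x|M. (norm (\<Sum>k\<in>K. y k *\<^sub>R V k x))\<^sup>2) = (\<Sum>k\<in>K. (y k)\<^sup>2)"
    using integral_norm_sum_squared[of K V M y] V by simp
  have cross: "(LINT x|M. (\<Sum>k\<in>K. y k *\<^sub>R V k x) \<bullet> W x) = (\<Sum>k\<in>K. y k * c k)"
    unfolding c_def using V W by (simp add: inner_sum_left square_integrable_inner integral_sum)
  have "(LINT x|M. (norm ((\<Sum>k\<in>K. y k *\<^sub>R V k x) - W x))\<^sup>2) =
      (LINT x|M. (norm (\<Sum>k\<in>K. y k *\<^sub>R V k x))\<^sup>2 + (norm (W x))\<^sup>2 - 2 * ((\<Sum>k\<in>K. y k *\<^sub>R V k x) \<bullet> W x))"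
    by (intro Bochner_Integration.integral_cong refl)
      (simp add: power2_norm_eq_inner inner_diff_left inner_diff_right inner_commute)
  also have "\<dots> = (\<Sum>k\<in>K. (y k)\<^sup>2) + (LINT x|M. (norm (W x))\<^sup>2) - 2 * (\<Sum>k\<in>K. y k * c k)"
    using square_integrableD(2)[OF S] square_integrableD(2)[OF W] square_integrable_inner[OF S W]
    by (simp add: sq cross)
  also have "\<dots> = (\<Sum>k\<in>K. (y k - c k)\<^sup>2) + ((LINT x|M. (norm (W x))\<^sup>2) - (\<Sum>k\<in>K. (c k)\<^sup>2))"
    by (simp add: power2_diff sum.distrib sum_subtractf sum_distrib_left algebra_simps)
  finally show ?thesis .
qed

section \<open>Sample means and conditionally identically distributed pairs\<close>

text \<open>
  Expanding the square, products of centred terms at two different samples integrate to zero, and only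
  the \<open>M\<close> diagonal terms remain.
\<close>

lemma PiM_sample_mean_variance:
  assumes Q: "prob_space Q" and g: "g \<in> square_integrable Q" and M: "M \<ge> 1"
    and c: "c = (LINT z|Q. g z)"
  defines "d \<equiv> \<lambda>D. (1 / real M) * (\<Sum>m=1..M. g (D m)) - c"
  shows "integrable (PiM {1..M} (\<lambda>_. Q)) (\<lambda>D. (d D)\<^sup>2)"
    and "(LINT D|PiM {1..M} (\<lambda>_. Q). (d D)\<^sup>2) \<le> (LINT z|Q. (g z)\<^sup>2) / real M"
proof -
  interpret Q: prob_space Q by fact
  interpret product_sigma_finite "\<lambda>_::nat. Q" by unfold_locales
  interpret PP: prob_space "PiM {1..M} (\<lambda>_. Q)" by (intro prob_space_PiM Q)
  have [measurable]: "g \<in> borel_measurable Q" and g2: "integrable Q (\<lambda>z. (g z)\<^sup>2)"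
    using square_integrableD[OF g] by auto
  have g1: "integrable Q g" using g2 by (rule Q.square_integrable_imp_integrable[rotated]) measurable
  define h where "h = (\<lambda>z. g z - c)"
  have h1: "integrable Q h" "(LINT z|Q. h z) = 0"
    using g1 by (simp_all add: h_def Q.prob_space flip: c)
  have h2: "integrable Q (\<lambda>z. (h z)\<^sup>2)"
    using g1 g2 by (simp add: h_def power2_diff)
  have h2_le: "(LINT z|Q. (h z)\<^sup>2) \<le> (LINT z|Q. (g z)\<^sup>2)"
    using g1 g2 by (simp add: h_def power2_diff Q.prob_space flip: c) (simp add: power2_eq_square)
  have pair: "integrable (PiM {1..M} (\<lambda>_. Q)) (\<lambda>D. h (D i) * h (D j))
      \<and> (LINT D|PiM {1..M} (\<lambda>_. Q). h (D i) * h (D j)) = (if i = j then LINT z|Q. (h z)\<^sup>2 else 0)"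
    if ij: "i \<in> {1..M}" "j \<in> {1..M}" for i j
  proof -
    \<comment> \<open>A product over all samples whose factors away from \<open>i\<close> and \<open>j\<close> are \<open>1\<close>, so that integration
      factorises; for \<open>i = j\<close> both conditions select the same factor, which becomes a square.\<close>
    define f where "f k = (\<lambda>z. (if k = i then h z else 1) * (if k = j then h z else 1))" for k
    have f: "integrable Q (f k)" for k
      using h1 h2 by (cases "k = i"; cases "k = j") (simp_all add: f_def power2_eq_square)
    have eq: "(\<Prod>k=1..M. f k (D k)) = h (D i) * h (D j)" for D
      unfolding f_def using ij by (simp add: prod.distrib)
    have "(\<Prod>k=1..M. LINT z|Q. f k z) = (if i = j then LINT z|Q. (h z)\<^sup>2 else 0)"
    proof (cases "i = j")
      case True
      then have "(\<Prod>k=1..M. LINT z|Q. f k z) = (\<Prod>k=1..M. if k = i then LINT z|Q. (h z)\<^sup>2 else 1)"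
        by (intro prod.cong) (auto simp: f_def power2_eq_square Q.prob_space)
      with True ij show ?thesis by simp
    next
      case False
      then have "(LINT z|Q. f i z) = 0" using h1 by (simp add: f_def)
      then have "(\<Prod>k=1..M. LINT z|Q. f k z) = 0"
        using ij by (intro prod_zero bexI[of _ i]) auto
      with False show ?thesis by simp
    qed
    then show ?thesis
      using product_integrable_prod[of "{1..M}" f] product_integral_prod[of "{1..M}" f] f
      unfolding eq by simp
  qed
  have d_eq: "(d D)\<^sup>2 = (1 / real M)\<^sup>2 * (\<Sum>i=1..M. \<Sum>j=1..M. h (D i) * h (D j))" for D
  proof -
    have "d D = (1 / real M) * (\<Sum>m=1..M. h (D m))"
      using M by (simp add: d_def h_def sum_subtractf field_simps)
    then show ?thesis
      by (simp only: power_mult_distrib power2_eq_square[of "sum _ _"] sum_product)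
  qed
  show "integrable (PiM {1..M} (\<lambda>_. Q)) (\<lambda>D. (d D)\<^sup>2)"
    unfolding d_eq
    by (intro Bochner_Integration.integrable_mult_right Bochner_Integration.integrable_sum) (use pair in blast)
  have "(LINT D|PiM {1..M} (\<lambda>_. Q). (d D)\<^sup>2) =
     (1 / real M)\<^sup>2 * (\<Sum>i=1..M. \<Sum>j=1..M. if i = j then LINT z|Q. (h z)\<^sup>2 else 0)"
  proof -
    have "(LINT D|PiM {1..M} (\<lambda>_. Q). (\<Sum>i=1..M. \<Sum>j=1..M. h (D i) * h (D j))) =
        (\<Sum>i=1..M. (LINT D|PiM {1..M} (\<lambda>_. Q). (\<Sum>j=1..M. h (D i) * h (D j))))"
      by (intro Bochner_Integration.integral_sum Bochner_Integration.integrable_sum) (use pair in blast)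
    also have "\<dots> = (\<Sum>i=1..M. \<Sum>j=1..M. (LINT D|PiM {1..M} (\<lambda>_. Q). h (D i) * h (D j)))"
      by (intro sum.cong refl Bochner_Integration.integral_sum) (use pair in blast)
    also have "\<dots> = (\<Sum>i=1..M. \<Sum>j=1..M. if i = j then LINT z|Q. (h z)\<^sup>2 else 0)"
      by (intro sum.cong refl) (use pair in blast)
    finally show ?thesis unfolding d_eq by simp
  qed
  also have "\<dots> = (LINT z|Q. (h z)\<^sup>2) / real M"
    using M by (simp add: power2_eq_square)
  also have "\<dots> \<le> (LINT z|Q. (g z)\<^sup>2) / real M"
    using h2_le by (intro divide_right_mono) auto
  finally show "(LINT D|PiM {1..M} (\<lambda>_. Q). (d D)\<^sup>2) \<le> (LINT z|Q. (g z)\<^sup>2) / real M" .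
qed

lemma simple_function_borel_representation:
  fixes s :: "'a::topological_space \<Rightarrow> real"
  assumes "simple_function borel s"
  shows "finite (range s)" "\<And>y. s -` {y} \<in> sets borel"
    "\<And>x. s x = (\<Sum>y\<in>range s. y * indicator (s -` {y}) x)"
proof -
  show fin: "finite (range s)" using simple_functionD(1)[OF assms] by simp
  show "s -` {y} \<in> sets borel" for y using simple_functionD(2)[OF assms, of "{y}"] by simp
  show "s x = (\<Sum>y\<in>range s. y * indicator (s -` {y}) x)" for x
  proof -
    have "(\<Sum>y\<in>range s. y * indicator (s -` {y}) x) = (\<Sum>y\<in>range s. if y = s x then y else 0)"
      by (intro sum.cong) (auto simp: indicator_def)
    then show ?thesis using fin by simp
  qed
qed

text \<open>
  With \<open>h = E (g (U) | F) = E (g (V) | F)\<close>, conditional independence gives \<open>E (g (U) g (V)) = E h\<^sup>2\<close>. The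
  hypotheses speak of conditional probabilities of events, so this is carried out for simple functions,
  where \<open>h\<close> is the corresponding combination of conditional probabilities, and passed to the limit by
  dominated convergence.
\<close>

lemma conditionally_iid_product_nonneg:
  fixes U V :: "'w \<Rightarrow> 'a::topological_space" and g :: "'a \<Rightarrow> real"
  assumes P: "prob_space P" and F: "subalgebra P F"
    and [measurable]: "U \<in> borel_measurable P" "V \<in> borel_measurable P" "g \<in> borel_measurable borel"
    and indep: "cond_indep P F U V" and same: "cond_same_law P F U V"
    and int: "integrable P (\<lambda>\<omega>. g (U \<omega>) * g (V \<omega>))"
  shows "0 \<le> (LINT \<omega>|P. g (U \<omega>) * g (V \<omega>))"
proof -
  interpret prob_space P by fact
  interpret finite_measure_subalgebra P F by unfold_locales fact
  define p where "p A = cond_prob P F {\<omega>\<in>space P. U \<omega> \<in> A}" for A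
  have events: "integrable P (\<lambda>\<omega>. indicator A (U \<omega>) * indicator B (V \<omega>) :: real)"
      "integrable P (\<lambda>\<omega>. p A \<omega> * p B \<omega>)"
      "(LINT \<omega>|P. indicator A (U \<omega>) * indicator B (V \<omega>)) = (LINT \<omega>|P. p A \<omega> * p B \<omega>)"
    if [measurable]: "A \<in> sets borel" "B \<in> sets borel" for A B
  proof -
    define E where "E = {\<omega>\<in>space P. U \<omega> \<in> A \<and> V \<omega> \<in> B}"
    have [measurable]: "E \<in> sets P" unfolding E_def by measurable
    have int_E: "integrable P (indicator E :: _ \<Rightarrow> real)"
      by (simp add: emeasure_eq_measure)
    have eq: "indicator A (U \<omega>) * indicator B (V \<omega>) = (indicator E \<omega> :: real)" if "\<omega> \<in> space P" for \<omega>
      using that by (auto simp: E_def indicator_def)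
    show "integrable P (\<lambda>\<omega>. indicator A (U \<omega>) * indicator B (V \<omega>) :: real)"
      using int_E by (simp add: eq cong: Bochner_Integration.integrable_cong)
    have [measurable]: "p A \<in> borel_measurable P" "p B \<in> borel_measurable P"
      by (auto simp: p_def cond_prob_def)
    have ae: "AE \<omega> in P. real_cond_exp P F (indicator E) \<omega> = p A \<omega> * p B \<omega>"
    proof -
      have "AE \<omega> in P. cond_prob P F E \<omega> = p A \<omega> * cond_prob P F {\<omega>\<in>space P. V \<omega> \<in> B} \<omega>"
        using indep unfolding cond_indep_def E_def p_def by auto
      moreover have "AE \<omega> in P. p B \<omega> = cond_prob P F {\<omega>\<in>space P. V \<omega> \<in> B} \<omega>"
        using same unfolding cond_same_law_def p_def by auto
      ultimately show ?thesis by eventually_elim (simp add: cond_prob_def)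
    qed
    have "integrable P (\<lambda>\<omega>. p A \<omega> * p B \<omega>) \<longleftrightarrow> integrable P (real_cond_exp P F (indicator E))"
      using ae by (intro integrable_cong_AE) auto
    then show "integrable P (\<lambda>\<omega>. p A \<omega> * p B \<omega>)" using real_cond_exp_int(1)[OF int_E] by simp
    have "(LINT \<omega>|P. p A \<omega> * p B \<omega>) = (LINT \<omega>|P. real_cond_exp P F (indicator E) \<omega>)"
      using ae by (intro integral_cong_AE) auto
    also have "\<dots> = (LINT \<omega>|P. indicator E \<omega>)" by (rule real_cond_exp_int(2)[OF int_E])
    also have "\<dots> = (LINT \<omega>|P. indicator A (U \<omega>) * indicator B (V \<omega>))"
      by (intro Bochner_Integration.integral_cong refl) (simp add: eq)
    finally show "(LINT \<omega>|P. indicator A (U \<omega>) * indicator B (V \<omega>)) = (LINT \<omega>|P. p A \<omega> * p B \<omega>)" ..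
  qed
  have simple: "0 \<le> (LINT \<omega>|P. s (U \<omega>) * s (V \<omega>))" if "simple_function borel s" for s :: "'a \<Rightarrow> real"
  proof -
    note rep = simple_function_borel_representation[OF that]
    let ?A = "\<lambda>y. s -` {y}"
    have "(LINT \<omega>|P. s (U \<omega>) * s (V \<omega>)) =
       (LINT \<omega>|P. (\<Sum>y\<in>range s. \<Sum>z\<in>range s. y * z * (indicator (?A y) (U \<omega>) * indicator (?A z) (V \<omega>))))"
      by (subst (1 2) rep(3)) (simp add: sum_product mult_ac)
    also have "\<dots> = (\<Sum>y\<in>range s. \<Sum>z\<in>range s. y * z * (LINT \<omega>|P. p (?A y) \<omega> * p (?A z) \<omega>))"
      using events[OF rep(2) rep(2)] by (simp add: integral_sum)
    also have "\<dots> = (LINT \<omega>|P. (\<Sum>y\<in>range s. \<Sum>z\<in>range s. y * z * (p (?A y) \<omega> * p (?A z) \<omega>)))"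
      using events[OF rep(2) rep(2)] by (simp add: integral_sum)
    also have "\<dots> = (LINT \<omega>|P. (\<Sum>y\<in>range s. y * p (?A y) \<omega>)\<^sup>2)"
      by (simp add: power2_eq_square sum_product mult_ac)
    also have "\<dots> \<ge> 0" by simp
    finally show ?thesis .
  qed
  obtain s where s: "\<And>n. simple_function borel (s n :: 'a \<Rightarrow> real)"
      and lim: "\<And>x. (\<lambda>n. s n x) \<longlonglongrightarrow> g x" and bound: "\<And>n x. \<bar>s n x\<bar> \<le> 2 * \<bar>g x\<bar>"
    using borel_measurable_implies_sequence_metric[of g borel 0] by auto
  have [measurable]: "s n \<in> borel_measurable borel" for n
    using s by (rule borel_measurable_simple_function)
  have "(\<lambda>n. LINT \<omega>|P. s n (U \<omega>) * s n (V \<omega>)) \<longlonglongrightarrow> (LINT \<omega>|P. g (U \<omega>) * g (V \<omega>))"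
  proof (rule integral_dominated_convergence)
    show "integrable P (\<lambda>\<omega>. 4 * \<bar>g (U \<omega>) * g (V \<omega>)\<bar>)" using int by auto
    show "AE \<omega> in P. (\<lambda>n. s n (U \<omega>) * s n (V \<omega>)) \<longlonglongrightarrow> g (U \<omega>) * g (V \<omega>)"
      by (intro AE_I2 tendsto_mult lim)
    show "AE \<omega> in P. norm (s n (U \<omega>) * s n (V \<omega>)) \<le> 4 * \<bar>g (U \<omega>) * g (V \<omega>)\<bar>" for n
    proof (rule AE_I2)
      fix \<omega>
      have "\<bar>s n (U \<omega>)\<bar> * \<bar>s n (V \<omega>)\<bar> \<le> (2 * \<bar>g (U \<omega>)\<bar>) * (2 * \<bar>g (V \<omega>)\<bar>)"
        by (intro mult_mono bound) auto
      then show "norm (s n (U \<omega>) * s n (V \<omega>)) \<le> 4 * \<bar>g (U \<omega>) * g (V \<omega>)\<bar>"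
        by (simp add: abs_mult)
    qed
  qed measurable
  then show ?thesis using simple[OF s] by (intro LIMSEQ_le_const) auto
qed

section \<open>The exploration measure\<close>

text \<open>
  Every integral against the exploration measure is an average over ordered pairs of particles. This
  extends the defining identity from indicators by the usual measure-theoretic induction.
\<close>

lemma nn_integral_exploration:
  fixes X :: "'w \<Rightarrow> (real^'d)^'n"
  assumes P: "prob_space P" and X: "X \<in> borel_measurable P" and f: "f \<in> borel_measurable borel"
  shows "(\<integral>\<^sup>+r. f r \<partial>exploration P X) = ennreal (1 / (real CARD('n) * (real CARD('n) - 1))) *
    (\<Sum>i\<in>UNIV. \<Sum>j\<in>UNIV - {i}. \<integral>\<^sup>+\<omega>. f (norm (X \<omega> $ i - X \<omega> $ j)) \<partial>P)"
  using f
proof (induction rule: borel_measurable_induct)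
  interpret prob_space P by fact
  have [measurable]: "(\<lambda>\<omega>. X \<omega> $ i) \<in> borel_measurable P" for i
    using X by (rule measurable_compose) (intro borel_measurable_continuous_onI continuous_intros)
  have meas [simp]: "f \<in> borel_measurable (exploration P X) \<longleftrightarrow> f \<in> borel_measurable borel" for f :: "real \<Rightarrow> ennreal"
    by (simp cong: measurable_cong_sets)
  { case (cong f g)
    then show ?case by simp
  next
    case (set A)
    then have [measurable]: "A \<in> sets borel" by simp
    have ind: "(\<integral>\<^sup>+\<omega>. indicator A (norm (X \<omega> $ i - X \<omega> $ j)) \<partial>P) =
       ennreal (measure P {\<omega>\<in>space P. norm (X \<omega> $ i - X \<omega> $ j) \<in> A})" for i j
    proof -
      have "(\<integral>\<^sup>+\<omega>. indicator A (norm (X \<omega> $ i - X \<omega> $ j)) \<partial>P)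
          = (\<integral>\<^sup>+\<omega>. indicator {\<omega>\<in>space P. norm (X \<omega> $ i - X \<omega> $ j) \<in> A} \<omega> \<partial>P)"
        by (intro nn_integral_cong) (auto simp: indicator_def)
      also have "\<dots> = emeasure P {\<omega>\<in>space P. norm (X \<omega> $ i - X \<omega> $ j) \<in> A}"
        using set by (intro nn_integral_indicator) measurable
      finally show ?thesis by (simp add: emeasure_eq_measure)
    qed
    show ?case
      using set by (simp add: ind emeasure_exploration[OF P X] sum_nonneg,
          subst ennreal_mult''[symmetric], auto intro!: sum_nonneg)
  next
    case (mult u c)
    then show ?case
      by (simp add: nn_integral_cmult sum_distrib_left mult_ac)
  next
    case (add u v)
    then show ?case
      by (simp add: nn_integral_add sum.distrib distrib_left)
  next
    case (seq U)
    have [measurable]: "U n \<in> borel_measurable borel" for n using seq by auto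
    have inc: "incseq (\<lambda>n \<omega>. U n (norm (X \<omega> $ i - X \<omega> $ j)))" for i j
      using seq by (auto simp: incseq_def le_fun_def)
    have "(\<integral>\<^sup>+r. (SUP n. U n) r \<partial>exploration P X) = (SUP n. \<integral>\<^sup>+r. U n r \<partial>exploration P X)"
      using seq by (simp add: nn_integral_monotone_convergence_SUP image_comp)
    also have "\<dots> = (SUP n. ennreal (1 / (real CARD('n) * (real CARD('n) - 1))) *
        (\<Sum>i\<in>UNIV. \<Sum>j\<in>UNIV - {i}. \<integral>\<^sup>+\<omega>. U n (norm (X \<omega> $ i - X \<omega> $ j)) \<partial>P))"
      using seq by simp
    also have "\<dots> = ennreal (1 / (real CARD('n) * (real CARD('n) - 1))) *
        (\<Sum>i\<in>UNIV. \<Sum>j\<in>UNIV - {i}. SUP n. \<integral>\<^sup>+\<omega>. U n (norm (X \<omega> $ i - X \<omega> $ j)) \<partial>P)"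
    proof -
      have m: "incseq (\<lambda>n. \<integral>\<^sup>+\<omega>. U n (norm (X \<omega> $ i - X \<omega> $ j)) \<partial>P)" for i j
        using inc[of i j] by (auto simp: incseq_def le_fun_def intro!: nn_integral_mono)
      have "(SUP n. \<Sum>i\<in>UNIV. \<Sum>j\<in>UNIV - {i}. \<integral>\<^sup>+\<omega>. U n (norm (X \<omega> $ i - X \<omega> $ j)) \<partial>P) =
          (\<Sum>i\<in>UNIV. SUP n. \<Sum>j\<in>UNIV - {i}. \<integral>\<^sup>+\<omega>. U n (norm (X \<omega> $ i - X \<omega> $ j)) \<partial>P)"
        by (rule ennreal_SUP_sum) (use m in \<open>auto simp: incseq_def intro!: sum_mono\<close>)
      also have "\<dots> = (\<Sum>i\<in>UNIV. \<Sum>j\<in>UNIV - {i}. SUP n. \<integral>\<^sup>+\<omega>. U n (norm (X \<omega> $ i - X \<omega> $ j)) \<partial>P)"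
        by (intro sum.cong refl ennreal_SUP_sum m)
      finally show ?thesis by (simp flip: SUP_mult_left_ennreal)
    qed
    also have "\<dots> = ennreal (1 / (real CARD('n) * (real CARD('n) - 1))) *
      (\<Sum>i\<in>UNIV. \<Sum>j\<in>UNIV - {i}. \<integral>\<^sup>+\<omega>. (SUP n. U n) (norm (X \<omega> $ i - X \<omega> $ j)) \<partial>P)"
      using inc by (simp add: image_comp flip: nn_integral_monotone_convergence_SUP)
    finally show ?case .
  }
qed

text \<open>
  Each ordered pair enters the exploration measure with positive weight, so its null sets are null for
  every single distance.
\<close>

lemma AE_exploration_imp_AE_distance:
  fixes X :: "'w \<Rightarrow> (real^'d)^'n"
  assumes P: "prob_space P" and X: "X \<in> borel_measurable P" and card: "CARD('n) \<ge> 2"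
    and ae: "AE r in exploration P X. Q r" and ij: "i \<noteq> j"
  shows "AE \<omega> in P. Q (norm (X \<omega> $ i - X \<omega> $ j))"
proof -
  have [measurable]: "(\<lambda>\<omega>. X \<omega> $ i) \<in> borel_measurable P" for i
    using X by (rule measurable_compose) (intro borel_measurable_continuous_onI continuous_intros)
  obtain N where N: "{r. \<not> Q r} \<subseteq> N" "emeasure (exploration P X) N = 0" "N \<in> sets borel"
    using ae by (auto elim!: AE_E)
  note [measurable] = N(3)
  have "(\<integral>\<^sup>+r. indicator N r \<partial>exploration P X) = 0"
    using N by simp
  moreover have "1 / (real CARD('n) * (real CARD('n) - 1)) > 0"
    using card by simp
  ultimately have "(\<integral>\<^sup>+\<omega>. indicator N (norm (X \<omega> $ i - X \<omega> $ j)) \<partial>P) = 0"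
    using ij nn_integral_exploration[OF P X, of "indicator N"]
    by (auto simp: ennreal_eq_0_iff mult_eq_0_iff not_le)
  then have "AE \<omega> in P. indicator N (norm (X \<omega> $ i - X \<omega> $ j)) = (0::ennreal)"
    by (subst (asm) nn_integral_0_iff_AE) simp_all
  then show ?thesis
    by eventually_elim (use N(1) in \<open>auto simp: indicator_def split: if_splits\<close>)
qed

lemma zero_ext_measurable:
  assumes "f \<in> borel_measurable (on_unit (exploration P X))"
  shows "zero_ext f \<in> borel_measurable borel"
proof -
  have "(\<lambda>r. indicator {0..1} r *\<^sub>R f r) \<in> borel_measurable (exploration P X)"
    using assms unfolding on_unit_def by (subst (asm) borel_measurable_restrict_space_iff) auto
  moreover have "(\<lambda>r. indicator {0..1} r *\<^sub>R f r) = zero_ext f"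
    by (auto simp: zero_ext_def)
  ultimately show ?thesis by (simp cong: measurable_cong_sets)
qed

lemma zero_ext_square_integrable:
  assumes "f \<in> square_integrable (on_unit (exploration P X))"
  shows "integrable (exploration P X) (\<lambda>r. (zero_ext f r)\<^sup>2)"
    and "(LINT r|exploration P X. (zero_ext f r)\<^sup>2) = (LINT r|on_unit (exploration P X). (f r)\<^sup>2)"
proof -
  have eq: "(zero_ext f r)\<^sup>2 = indicator {0..1} r *\<^sub>R (f r)\<^sup>2" for r
    by (simp add: zero_ext_def)
  show "integrable (exploration P X) (\<lambda>r. (zero_ext f r)\<^sup>2)"
    using square_integrableD(2)[OF assms] unfolding on_unit_def eq
    by (subst (asm) integrable_restrict_space) auto
  show "(LINT r|exploration P X. (zero_ext f r)\<^sup>2) = (LINT r|on_unit (exploration P X). (f r)\<^sup>2)"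
    unfolding on_unit_def eq by (subst integral_restrict_space) auto
qed

lemma integral_exploration:
  fixes X :: "'w \<Rightarrow> (real^'d)^'n" and f :: "real \<Rightarrow> real"
  assumes P: "prob_space P" and X: "X \<in> borel_measurable P" and card: "CARD('n) \<ge> 2"
    and nonneg: "\<And>r. 0 \<le> f r" and int: "integrable (exploration P X) f"
  shows "\<And>i j. i \<noteq> j \<Longrightarrow> integrable P (\<lambda>\<omega>. f (norm (X \<omega> $ i - X \<omega> $ j)))"
    and "(\<Sum>i\<in>UNIV. \<Sum>j\<in>UNIV - {i}. LINT \<omega>|P. f (norm (X \<omega> $ i - X \<omega> $ j))) =
      real CARD('n) * (real CARD('n) - 1) * (LINT r|exploration P X. f r)"
proof -
  have [measurable]: "(\<lambda>\<omega>. X \<omega> $ i) \<in> borel_measurable P" for i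
    using X by (rule measurable_compose) (intro borel_measurable_continuous_onI continuous_intros)
  have [measurable]: "f \<in> borel_measurable borel"
    using borel_measurable_integrable[OF int] by (simp cong: measurable_cong_sets)
  define c where "c = 1 / (real CARD('n) * (real CARD('n) - 1))"
  have c: "c > 0" using card by (simp add: c_def)
  define I where "I i j = (\<integral>\<^sup>+\<omega>. ennreal (f (norm (X \<omega> $ i - X \<omega> $ j))) \<partial>P)" for i j
  have eq: "(\<integral>\<^sup>+r. ennreal (f r) \<partial>exploration P X) = ennreal c * (\<Sum>i\<in>UNIV. \<Sum>j\<in>UNIV - {i}. I i j)"
    unfolding c_def I_def by (rule nn_integral_exploration[OF P X]) measurable
  have "(\<integral>\<^sup>+r. ennreal (f r) \<partial>exploration P X) < \<infinity>"
    using int nonneg by (simp add: integrable_iff_bounded)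
  then have "(\<Sum>i\<in>UNIV. \<Sum>j\<in>UNIV - {i}. I i j) < \<infinity>"
    using c unfolding eq by (auto simp: ennreal_mult_less_top less_top[symmetric] ennreal_mult_eq_top_iff)
  then have fin: "I i j < \<infinity>" if "i \<noteq> j" for i j
    using that by (auto simp: less_top[symmetric])
  show int_ij: "integrable P (\<lambda>\<omega>. f (norm (X \<omega> $ i - X \<omega> $ j)))" if "i \<noteq> j" for i j
    using fin[OF that] nonneg by (simp add: integrable_iff_bounded I_def)
  have I_eq: "I i j = ennreal (LINT \<omega>|P. f (norm (X \<omega> $ i - X \<omega> $ j)))" if "i \<noteq> j" for i j
    unfolding I_def using int_ij[OF that] nonneg by (intro nn_integral_eq_integral) auto
  have "ennreal (LINT r|exploration P X. f r) = (\<integral>\<^sup>+r. ennreal (f r) \<partial>exploration P X)"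
    using int nonneg by (intro nn_integral_eq_integral[symmetric]) auto
  also have "\<dots> = ennreal c * (\<Sum>i\<in>UNIV. \<Sum>j\<in>UNIV - {i}. ennreal (LINT \<omega>|P. f (norm (X \<omega> $ i - X \<omega> $ j))))"
    unfolding eq by (intro arg_cong2[where f="(*)"] refl sum.cong) (auto simp: I_eq)
  also have "\<dots> = ennreal (c * (\<Sum>i\<in>UNIV. \<Sum>j\<in>UNIV - {i}. LINT \<omega>|P. f (norm (X \<omega> $ i - X \<omega> $ j))))"
    using c nonneg by (simp add: ennreal_mult sum_nonneg integral_nonneg)
  finally have "(LINT r|exploration P X. f r) =
      c * (\<Sum>i\<in>UNIV. \<Sum>j\<in>UNIV - {i}. LINT \<omega>|P. f (norm (X \<omega> $ i - X \<omega> $ j)))"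
    using c nonneg by (subst (asm) ennreal_inj) (auto intro!: mult_nonneg_nonneg sum_nonneg integral_nonneg)
  then show "(\<Sum>i\<in>UNIV. \<Sum>j\<in>UNIV - {i}. LINT \<omega>|P. f (norm (X \<omega> $ i - X \<omega> $ j))) =
      real CARD('n) * (real CARD('n) - 1) * (LINT r|exploration P X. f r)"
    using card by (simp add: c_def field_simps)
qed

section \<open>The interaction operator\<close>

abbreviation force :: "(real \<Rightarrow> real) \<Rightarrow> (real^'d)^'n \<Rightarrow> (real^'d)^'n" where
  "force f \<equiv> interaction (zero_ext f)"

definition pair_force :: "(real \<Rightarrow> real) \<Rightarrow> real^'d \<Rightarrow> real^'d" where
  "pair_force f z = zero_ext f (norm z) *\<^sub>R (z /\<^sub>R norm z)"

lemma force_nth: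
  "force f x $ i = (1 / (real CARD('n) - 1)) *\<^sub>R (\<Sum>j\<in>UNIV - {i}. pair_force f (x $ i - x $ j))"
  for x :: "(real^'d)^'n"
  by (simp add: interaction_def pair_force_def)

lemma zero_ext_sum: "zero_ext (\<lambda>r. \<Sum>k\<in>K. c k * f k r) r = (\<Sum>k\<in>K. c k * zero_ext (f k) r)"
  by (cases "r \<in> {0..1}") (simp_all only: zero_ext_def if_True if_False mult_zero_right sum.neutral_const)

lemma zero_ext_diff: "zero_ext (\<lambda>r. f r - g r) r = zero_ext f r - zero_ext g r"
  by (simp add: zero_ext_def)

lemma force_sum: "force (\<lambda>r. \<Sum>k\<in>K. c k * f k r) x = (\<Sum>k\<in>K. c k *\<^sub>R force (f k) x)"
  by (simp add: vec_eq_iff force_nth pair_force_def zero_ext_sum scaleR_sum_left scaleR_sum_right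
      sum_distrib_left mult_ac sum.swap[of _ K])

lemma force_diff: "force (\<lambda>r. f r - g r) x = force f x - force g x"
  by (simp add: vec_eq_iff force_nth pair_force_def zero_ext_diff algebra_simps sum_subtractf
      flip: scaleR_right_diff_distrib)

lemma norm_pair_force: "norm (pair_force f z) = (if z = 0 then 0 else \<bar>zero_ext f (norm z)\<bar>)"
  by (auto simp: pair_force_def abs_mult)

lemma norm_vec_squared: "(norm x)\<^sup>2 = (\<Sum>i\<in>UNIV. (norm (x $ i))\<^sup>2)"
  for x :: "'b::euclidean_space^'n"
  by (simp add: power2_norm_eq_inner inner_vec_def)

lemma norm_sum_squared_le:
  "(norm (\<Sum>j\<in>K. v j))\<^sup>2 \<le> real (card K) * (\<Sum>j\<in>K. (norm (v j))\<^sup>2)"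
  for v :: "'k \<Rightarrow> 'b::real_normed_vector"
proof -
  have "(norm (\<Sum>j\<in>K. v j))\<^sup>2 \<le> (\<Sum>j\<in>K. 1 * norm (v j))\<^sup>2"
    by (intro power_mono) (auto intro: norm_sum)
  also have "\<dots> \<le> (\<Sum>j\<in>K. 1\<^sup>2) * (\<Sum>j\<in>K. (norm (v j))\<^sup>2)"
    by (rule Cauchy_Schwarz_ineq_sum)
  finally show ?thesis by simp
qed

lemma borel_measurable_vec_componentwise:
  fixes f :: "'a \<Rightarrow> 'b::euclidean_space^'n"
  assumes "\<And>i. (\<lambda>x. f x $ i) \<in> borel_measurable M"
  shows "f \<in> borel_measurable M"
proof (rule borel_measurable_euclidean_space[THEN iffD2], rule ballI)
  fix b :: "'b^'n"
  assume "b \<in> Basis"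
  then obtain i u where b: "b = axis i u" by (auto simp: Basis_vec_def)
  note [measurable] = assms
  show "(\<lambda>x. f x \<bullet> b) \<in> borel_measurable M"
    unfolding b inner_axis by measurable
qed

lemma borel_measurable_vec_nth [measurable]:
  "(\<lambda>x. x $ i) \<in> borel_measurable borel" for i :: "'n::finite"
  by (intro borel_measurable_continuous_onI continuous_intros)

lemma pair_force_measurable:
  assumes [measurable]: "zero_ext f \<in> borel_measurable borel"
  shows "pair_force f \<in> borel_measurable borel"
  unfolding pair_force_def by measurable

lemma force_measurable:
  assumes "zero_ext f \<in> borel_measurable borel"
  shows "(force f :: (real^'d)^'n \<Rightarrow> _) \<in> borel_measurable borel"
proof (rule borel_measurable_vec_componentwise)
  note [measurable] = pair_force_measurable[OF assms]
  show "(\<lambda>x :: (real^'d)^'n. force f x $ i) \<in> borel_measurable borel" for i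
    unfolding force_nth by measurable
qed

text \<open>
  A pair force vanishes at the origin whatever the value of the kernel there; everywhere else its length
  is the absolute value of the kernel at the distance. The two agree almost surely if collisions are
  null, which is stated through the exploration measure.
\<close>

locale particle_system = prob_space P for P :: "'w measure" +
  fixes X :: "'w \<Rightarrow> (real^'d)^'n"
  assumes X_measurable [measurable]: "X \<in> borel_measurable P"
    and card_ge: "CARD('n) \<ge> 2"
    and A2: "cond_indep_A2 P X"
    and no_collision: "emeasure (exploration P X) {0} = 0"
begin

definition \<mu> :: "real measure" where "\<mu> = on_unit (exploration P X)"

definition N :: real where "N = real CARD('n)"

lemma N_ge: "N \<ge> 2" using card_ge by (simp add: N_def)

lemma prob_space_P: "prob_space P" by (rule prob_space_axioms)

lemma distinct_positions: "i \<noteq> j \<Longrightarrow> AE \<omega> in P. X \<omega> $ i - X \<omega> $ j \<noteq> 0"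
proof -
  assume ij: "i \<noteq> j"
  have "AE r in exploration P X. r \<noteq> 0"
    using no_collision by (intro AE_I'[of "{0}"]) auto
  from AE_exploration_imp_AE_distance[OF prob_space_P X_measurable card_ge this ij]
  show ?thesis by simp
qed

context
  fixes f :: "real \<Rightarrow> real"
  assumes f: "f \<in> square_integrable \<mu>"
begin

lemma zero_ext_f [measurable]: "zero_ext f \<in> borel_measurable borel"
  using square_integrableD(1)[OF f] unfolding \<mu>_def by (rule zero_ext_measurable)

lemma pair_force_square_integrable:
  assumes "i \<noteq> j"
  shows "(\<lambda>\<omega>. pair_force f (X \<omega> $ i - X \<omega> $ j)) \<in> square_integrable P"
    and "(LINT \<omega>|P. (norm (pair_force f (X \<omega> $ i - X \<omega> $ j)))\<^sup>2) = (LINT \<omega>|P. (zero_ext f (norm (X \<omega> $ i - X \<omega> $ j)))\<^sup>2)"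
proof -
  note [measurable] = pair_force_measurable[OF zero_ext_f]
  have ae: "AE \<omega> in P. (norm (pair_force f (X \<omega> $ i - X \<omega> $ j)))\<^sup>2 = (zero_ext f (norm (X \<omega> $ i - X \<omega> $ j)))\<^sup>2"
    using distinct_positions[OF assms] by eventually_elim (simp add: norm_pair_force)
  show "(LINT \<omega>|P. (norm (pair_force f (X \<omega> $ i - X \<omega> $ j)))\<^sup>2) = (LINT \<omega>|P. (zero_ext f (norm (X \<omega> $ i - X \<omega> $ j)))\<^sup>2)"
    using ae by (intro integral_cong_AE) auto
  have "integrable P (\<lambda>\<omega>. (zero_ext f (norm (X \<omega> $ i - X \<omega> $ j)))\<^sup>2)"
    using zero_ext_square_integrable(1)[OF f[unfolded \<mu>_def]] assms
    by (intro integral_exploration(1)[OF prob_space_P X_measurable card_ge, where f="\<lambda>r. (zero_ext f r)\<^sup>2"]) auto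
  then have "integrable P (\<lambda>\<omega>. (norm (pair_force f (X \<omega> $ i - X \<omega> $ j)))\<^sup>2)"
  proof (rule integrable_cong_AE_imp)
    show "AE \<omega> in P. (zero_ext f (norm (X \<omega> $ i - X \<omega> $ j)))\<^sup>2 = (norm (pair_force f (X \<omega> $ i - X \<omega> $ j)))\<^sup>2"
      using ae by eventually_elim (rule sym)
  qed measurable
  then show "(\<lambda>\<omega>. pair_force f (X \<omega> $ i - X \<omega> $ j)) \<in> square_integrable P"
    unfolding square_integrable_def by (intro CollectI conjI) measurable
qed

lemma sum_pair_force_norms:
  "(\<Sum>i\<in>UNIV. \<Sum>j\<in>UNIV - {i}. LINT \<omega>|P. (norm (pair_force f (X \<omega> $ i - X \<omega> $ j)))\<^sup>2) =
    N * (N - 1) * (LINT r|\<mu>. (f r)\<^sup>2)"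
proof -
  have "(\<Sum>i\<in>UNIV. \<Sum>j\<in>UNIV - {i}. LINT \<omega>|P. (norm (pair_force f (X \<omega> $ i - X \<omega> $ j)))\<^sup>2) =
     (\<Sum>i\<in>UNIV. \<Sum>j\<in>UNIV - {i}. LINT \<omega>|P. (zero_ext f (norm (X \<omega> $ i - X \<omega> $ j)))\<^sup>2)"
    by (intro sum.cong refl pair_force_square_integrable(2)) auto
  also have "\<dots> = N * (N - 1) * (LINT r|exploration P X. (zero_ext f r)\<^sup>2)"
    unfolding N_def using zero_ext_square_integrable(1)[OF f[unfolded \<mu>_def]]
    by (intro integral_exploration(2)[OF prob_space_P X_measurable card_ge, where f="\<lambda>r. (zero_ext f r)\<^sup>2"]) auto
  also have "\<dots> = N * (N - 1) * (LINT r|\<mu>. (f r)\<^sup>2)"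
    using zero_ext_square_integrable(2)[OF f[unfolded \<mu>_def]] by (simp add: \<mu>_def)
  finally show ?thesis .
qed

text \<open>
  Each coordinate of a pair force is a function of the difference of the two positions, so the inner
  product is a sum of products of a conditionally i.i.d. pair.
\<close>

lemma pair_force_cross_nonneg:
  assumes "j \<noteq> j'" "i \<noteq> j" "i \<noteq> j'"
  shows "0 \<le> (LINT \<omega>|P. pair_force f (X \<omega> $ i - X \<omega> $ j) \<bullet> pair_force f (X \<omega> $ i - X \<omega> $ j'))"
proof -
  note [measurable] = pair_force_measurable[OF zero_ext_f]
  obtain F where F: "subalgebra P F"
      "cond_indep P F (\<lambda>\<omega>. X \<omega> $ i - X \<omega> $ j) (\<lambda>\<omega>. X \<omega> $ i - X \<omega> $ j')"
      "cond_same_law P F (\<lambda>\<omega>. X \<omega> $ i - X \<omega> $ j) (\<lambda>\<omega>. X \<omega> $ i - X \<omega> $ j')"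
    using A2[unfolded cond_indep_A2_def, THEN spec[of _ i], THEN spec[of _ j], THEN spec[of _ j']] assms
    by auto
  let ?g = "\<lambda>c z. pair_force f z $ c"
  have component: "(\<lambda>\<omega>. ?g c (X \<omega> $ i - X \<omega> $ k)) \<in> square_integrable P" if "i \<noteq> k" for c k
  proof -
    have "integrable P (\<lambda>\<omega>. (norm (?g c (X \<omega> $ i - X \<omega> $ k)))\<^sup>2)"
    proof (rule Bochner_Integration.integrable_bound)
      show "integrable P (\<lambda>\<omega>. (norm (pair_force f (X \<omega> $ i - X \<omega> $ k)))\<^sup>2)"
        using pair_force_square_integrable(1)[OF that] by (rule square_integrableD)
      show "AE \<omega> in P. norm ((norm (?g c (X \<omega> $ i - X \<omega> $ k)))\<^sup>2) \<le> norm ((norm (pair_force f (X \<omega> $ i - X \<omega> $ k)))\<^sup>2)"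
        by (intro AE_I2) (simp add: component_le_norm_cart flip: abs_le_square_iff)
    qed measurable
    then show ?thesis by (simp add: square_integrable_def)
  qed
  have int: "integrable P (\<lambda>\<omega>. ?g c (X \<omega> $ i - X \<omega> $ j) * ?g c (X \<omega> $ i - X \<omega> $ j'))" for c
    using square_integrable_inner[OF component[OF assms(2)] component[OF assms(3)]] by simp
  have "(LINT \<omega>|P. pair_force f (X \<omega> $ i - X \<omega> $ j) \<bullet> pair_force f (X \<omega> $ i - X \<omega> $ j')) =
      (\<Sum>c\<in>UNIV. LINT \<omega>|P. ?g c (X \<omega> $ i - X \<omega> $ j) * ?g c (X \<omega> $ i - X \<omega> $ j'))"
    using int by (simp add: inner_vec_def integral_sum)
  also have "\<dots> \<ge> 0"
    using F int by (intro sum_nonneg conditionally_iid_product_nonneg[OF prob_space_P]) auto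
  finally show ?thesis .
qed

lemma force_square_integrable: "(\<lambda>\<omega>. force f (X \<omega>)) \<in> square_integrable P"
proof -
  note [measurable] = force_measurable[OF zero_ext_f]
  have "(\<lambda>\<omega>. force f (X \<omega>) $ i) \<in> square_integrable P" for i
    unfolding force_nth
    by (intro square_integrable_scaleR square_integrable_sum pair_force_square_integrable) auto
  then show ?thesis
    by (auto simp: square_integrable_def norm_vec_squared intro!: Bochner_Integration.integrable_sum)
qed

lemma force_norm_squared:
  "(LINT \<omega>|P. (norm (force f (X \<omega>)))\<^sup>2) = (1 / (N - 1))\<^sup>2 *
     (\<Sum>i\<in>UNIV. LINT \<omega>|P. (norm (\<Sum>j\<in>UNIV - {i}. pair_force f (X \<omega> $ i - X \<omega> $ j)))\<^sup>2)"
proof -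
  have "integrable P (\<lambda>\<omega>. (norm (\<Sum>j\<in>UNIV - {i}. pair_force f (X \<omega> $ i - X \<omega> $ j)))\<^sup>2)" for i
    by (intro square_integrableD square_integrable_sum pair_force_square_integrable) auto
  then show ?thesis
    by (simp add: norm_vec_squared force_nth power_mult_distrib sum_distrib_left integral_sum N_def power_divide)
qed

text \<open>
  Identifiability of the kernel: of the expanded square of the force on each particle only the diagonal
  terms are kept, the others being nonnegative.
\<close>

lemma force_coercive:
  "N / (N - 1) * (LINT r|\<mu>. (f r)\<^sup>2) \<le> (LINT \<omega>|P. (norm (force f (X \<omega>)))\<^sup>2)"
proof -
  have "(\<Sum>j\<in>UNIV - {i}. LINT \<omega>|P. (norm (pair_force f (X \<omega> $ i - X \<omega> $ j)))\<^sup>2) \<le>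
    (LINT \<omega>|P. (norm (\<Sum>j\<in>UNIV - {i}. pair_force f (X \<omega> $ i - X \<omega> $ j)))\<^sup>2)" for i
  proof -
    let ?V = "\<lambda>j \<omega>. pair_force f (X \<omega> $ i - X \<omega> $ j)"
    have "(\<Sum>j\<in>UNIV - {i}. LINT \<omega>|P. (norm (?V j \<omega>))\<^sup>2) \<le>
       (\<Sum>p\<in>UNIV - {i}. \<Sum>q\<in>UNIV - {i}. LINT \<omega>|P. ?V p \<omega> \<bullet> ?V q \<omega>)"
    proof (rule sum_mono)
      fix p assume p: "p \<in> UNIV - {i}"
      have "(LINT \<omega>|P. (norm (?V p \<omega>))\<^sup>2) = (\<Sum>q\<in>{p}. LINT \<omega>|P. ?V p \<omega> \<bullet> ?V q \<omega>)"
        by (simp add: power2_norm_eq_inner)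
      also have "\<dots> \<le> (\<Sum>q\<in>UNIV - {i}. LINT \<omega>|P. ?V p \<omega> \<bullet> ?V q \<omega>)"
        using p by (intro sum_mono2 pair_force_cross_nonneg) auto
      finally show "(LINT \<omega>|P. (norm (?V p \<omega>))\<^sup>2) \<le> (\<Sum>q\<in>UNIV - {i}. LINT \<omega>|P. ?V p \<omega> \<bullet> ?V q \<omega>)" .
    qed
    also have "\<dots> = (LINT \<omega>|P. (norm (\<Sum>j\<in>UNIV - {i}. ?V j \<omega>))\<^sup>2)"
      using integral_norm_sum_squared[of "UNIV - {i}" ?V P "\<lambda>_. 1"] pair_force_square_integrable(1)[of i] by simp
    finally show ?thesis .
  qed
  then have "(1 / (N - 1))\<^sup>2 * (N * (N - 1) * (LINT r|\<mu>. (f r)\<^sup>2)) \<le> (LINT \<omega>|P. (norm (force f (X \<omega>)))\<^sup>2)"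
    unfolding force_norm_squared sum_pair_force_norms[symmetric] by (intro mult_left_mono sum_mono) auto
  then show ?thesis using N_ge by (simp add: power2_eq_square)
qed

lemma force_bounded:
  "(LINT \<omega>|P. (norm (force f (X \<omega>)))\<^sup>2) \<le> N * (LINT r|\<mu>. (f r)\<^sup>2)"
proof -
  have "(LINT \<omega>|P. (norm (\<Sum>j\<in>UNIV - {i}. pair_force f (X \<omega> $ i - X \<omega> $ j)))\<^sup>2) \<le>
      (N - 1) * (\<Sum>j\<in>UNIV - {i}. LINT \<omega>|P. (norm (pair_force f (X \<omega> $ i - X \<omega> $ j)))\<^sup>2)" for i
  proof -
    let ?V = "\<lambda>j \<omega>. pair_force f (X \<omega> $ i - X \<omega> $ j)"
    have V: "integrable P (\<lambda>\<omega>. (norm (?V j \<omega>))\<^sup>2)" if "j \<in> UNIV - {i}" for j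
      using that by (intro square_integrableD pair_force_square_integrable) auto
    have "(LINT \<omega>|P. (norm (\<Sum>j\<in>UNIV - {i}. ?V j \<omega>))\<^sup>2) \<le>
      (LINT \<omega>|P. (N - 1) * (\<Sum>j\<in>UNIV - {i}. (norm (?V j \<omega>))\<^sup>2))"
    proof (rule integral_mono)
      show "integrable P (\<lambda>\<omega>. (norm (\<Sum>j\<in>UNIV - {i}. ?V j \<omega>))\<^sup>2)"
        by (intro square_integrableD square_integrable_sum pair_force_square_integrable) auto
      show "integrable P (\<lambda>\<omega>. (N - 1) * (\<Sum>j\<in>UNIV - {i}. (norm (?V j \<omega>))\<^sup>2))"
        using V by (intro integrable_mult_right Bochner_Integration.integrable_sum) auto
      show "(norm (\<Sum>j\<in>UNIV - {i}. ?V j \<omega>))\<^sup>2 \<le> (N - 1) * (\<Sum>j\<in>UNIV - {i}. (norm (?V j \<omega>))\<^sup>2)" for \<omega>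
        using norm_sum_squared_le[of "\<lambda>j. ?V j \<omega>" "UNIV - {i}"] by (simp add: N_def card_Diff_singleton of_nat_diff)
    qed
    also have "\<dots> = (N - 1) * (\<Sum>j\<in>UNIV - {i}. LINT \<omega>|P. (norm (?V j \<omega>))\<^sup>2)"
      using V by (simp add: integral_sum)
    finally show ?thesis .
  qed
  then have "(LINT \<omega>|P. (norm (force f (X \<omega>)))\<^sup>2) \<le> (1 / (N - 1))\<^sup>2 *
      (\<Sum>i\<in>UNIV. (N - 1) * (\<Sum>j\<in>UNIV - {i}. LINT \<omega>|P. (norm (pair_force f (X \<omega> $ i - X \<omega> $ j)))\<^sup>2))"
    unfolding force_norm_squared by (intro mult_left_mono sum_mono) auto
  also have "\<dots> = (1 / (N - 1))\<^sup>2 * ((N - 1) * (N * (N - 1) * (LINT r|\<mu>. (f r)\<^sup>2)))"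
    unfolding sum_pair_force_norms[symmetric] by (simp add: sum_distrib_left)
  also have "\<dots> = N * (LINT r|\<mu>. (f r)\<^sup>2)"
    using N_ge by (simp add: power2_eq_square)
  finally show ?thesis .
qed

lemma force_AE_bounded:
  assumes B: "AE r in \<mu>. \<bar>f r\<bar> \<le> B" "B \<ge> 0"
  shows "AE \<omega> in P. (norm (force f (X \<omega>)))\<^sup>2 \<le> N * B\<^sup>2"
proof -
  have "AE r in exploration P X. \<bar>zero_ext f r\<bar> \<le> B"
  proof -
    have "AE r in exploration P X. r \<in> {0..1} \<longrightarrow> \<bar>f r\<bar> \<le> B"
      using B(1) unfolding \<mu>_def on_unit_def by (subst (asm) AE_restrict_space_iff) auto
    then show ?thesis by eventually_elim (use B(2) in \<open>auto simp: zero_ext_def\<close>)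
  qed
  then have "AE \<omega> in P. \<bar>zero_ext f (norm (X \<omega> $ i - X \<omega> $ j))\<bar> \<le> B" if "i \<noteq> j" for i j
    using that by (rule AE_exploration_imp_AE_distance[OF prob_space_P X_measurable card_ge])
  then have "AE \<omega> in P. \<forall>i. \<forall>j. i \<noteq> j \<longrightarrow> \<bar>zero_ext f (norm (X \<omega> $ i - X \<omega> $ j))\<bar> \<le> B"
    by (simp add: AE_all_countable)
  then show ?thesis
  proof eventually_elim
    case (elim \<omega>)
    have "norm (force f (X \<omega>) $ i) \<le> B" for i
    proof -
      have "norm (\<Sum>j\<in>UNIV - {i}. pair_force f (X \<omega> $ i - X \<omega> $ j)) \<le> (\<Sum>j\<in>UNIV - {i}. B)"
        using elim B(2) by (intro sum_norm_le) (auto simp: norm_pair_force)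
      also have "\<dots> = (N - 1) * B"
        by (simp add: N_def card_Diff_singleton of_nat_diff)
      finally show ?thesis
        using N_ge by (simp add: force_nth flip: N_def) (simp add: field_simps)
    qed
    then have "(\<Sum>i\<in>UNIV. (norm (force f (X \<omega>) $ i))\<^sup>2) \<le> (\<Sum>i\<in>(UNIV::'n set). B\<^sup>2)"
      by (intro sum_mono power_mono) auto
    then show ?case by (simp add: norm_vec_squared[of "force f (X \<omega>)"] N_def)
  qed
qed

end

end

section \<open>Sobolev classes\<close>

lemma Lp_norm_2_squared: "(Lp_norm M 2 f)\<^sup>2 = (LINT r|M. (f r)\<^sup>2)"
  by (simp add: Lp_norm_def flip: sqrt_def)

lemma sobolev_classE:
  assumes "\<phi> \<in> sobolev_class M \<psi> \<beta> L"
  obtains \<theta> where "\<phi> \<in> square_integrable M"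
    and "(\<lambda>n. LINT r|M. (\<phi> r - (\<Sum>k=1..n. \<theta> k * \<psi> k r))\<^sup>2) \<longlonglongrightarrow> 0"
    and "\<And>K. finite K \<Longrightarrow> K \<subseteq> {1..} \<Longrightarrow> (\<Sum>k\<in>K. real k powr (2 * \<beta>) * (\<theta> k)\<^sup>2) \<le> L\<^sup>2 / pi powr (2 * \<beta>)"
proof -
  from assms obtain \<theta> where \<theta>: "\<phi> \<in> Lp M 2" "L2_expansion M \<psi> \<theta> \<phi>"
      "(\<lambda>k. real k powr (2 * \<beta>) * (\<theta> k)\<^sup>2) summable_on {1..}"
      "(\<Sum>\<^sub>\<infinity>k\<in>{1..}. real k powr (2 * \<beta>) * (\<theta> k)\<^sup>2) \<le> L\<^sup>2 / pi powr (2 * \<beta>)"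
    unfolding sobolev_class_def by auto
  show ?thesis
  proof
    show "\<phi> \<in> square_integrable M" using \<theta>(1) by (simp add: Lp_2_eq_square_integrable)
    have "(\<lambda>n. (Lp_norm M 2 (\<lambda>r. \<phi> r - (\<Sum>k=1..n. \<theta> k * \<psi> k r)))\<^sup>2) \<longlonglongrightarrow> 0\<^sup>2"
      using \<theta>(2) unfolding L2_expansion_def by (rule tendsto_power)
    then show "(\<lambda>n. LINT r|M. (\<phi> r - (\<Sum>k=1..n. \<theta> k * \<psi> k r))\<^sup>2) \<longlonglongrightarrow> 0"
      by (simp add: Lp_norm_2_squared)
    show "(\<Sum>k\<in>K. real k powr (2 * \<beta>) * (\<theta> k)\<^sup>2) \<le> L\<^sup>2 / pi powr (2 * \<beta>)"
      if "finite K" "K \<subseteq> {1..}" for K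
      using finite_sum_le_infsum[OF \<theta>(3) that] \<theta>(4) by simp
  qed
qed

lemma orthonormal_sum_norm:
  assumes \<psi>: "complete_orthonormal_basis M \<psi>" and K: "finite K" "K \<subseteq> {1..}"
  shows "(LINT r|M. (\<Sum>k\<in>K. x k * \<psi> k r)\<^sup>2) = (\<Sum>k\<in>K. (x k)\<^sup>2)"
proof -
  have sq: "\<psi> k \<in> square_integrable M" if "k \<in> K" for k
    using \<psi> K that by (auto simp: complete_orthonormal_basis_def Lp_2_eq_square_integrable)
  have "(LINT r|M. (\<Sum>k\<in>K. x k * \<psi> k r)\<^sup>2) = (\<Sum>p\<in>K. \<Sum>q\<in>K. x p * x q * (LINT r|M. \<psi> p r * \<psi> q r))"
    using integral_norm_sum_squared[of K \<psi> M x] sq by simp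
  also have "\<dots> = (\<Sum>p\<in>K. \<Sum>q\<in>K. if p = q then (x p)\<^sup>2 else 0)"
    using \<psi> K by (intro sum.cong refl)
      (auto simp: complete_orthonormal_basis_def L2_inner_def power2_eq_square subset_iff)
  finally show ?thesis using K by simp
qed

text \<open>
  The partial sum at a later index \<open>m\<close> differs from the one at \<open>n\<close> by an orthonormal sum, whose energy the
  weights control; then \<open>m\<close> tends to infinity. The factor \<open>2\<close> is from \<open>(a + b)\<^sup>2 \<le> 2 a\<^sup>2 + 2 b\<^sup>2\<close>.
\<close>

lemma sobolev_tail_bound:
  assumes \<psi>: "complete_orthonormal_basis M \<psi>" and \<beta>: "\<beta> \<ge> 0" and n: "n \<ge> 1"
    and \<phi>: "\<phi> \<in> square_integrable M"
    and conv: "(\<lambda>n. LINT r|M. (\<phi> r - (\<Sum>k=1..n. \<theta> k * \<psi> k r))\<^sup>2) \<longlonglongrightarrow> 0"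
    and energy: "\<And>K. finite K \<Longrightarrow> K \<subseteq> {1..} \<Longrightarrow> (\<Sum>k\<in>K. real k powr (2 * \<beta>) * (\<theta> k)\<^sup>2) \<le> R"
  shows "(LINT r|M. (\<phi> r - (\<Sum>k=1..n. \<theta> k * \<psi> k r))\<^sup>2) \<le> 2 * R * real n powr (- 2 * \<beta>)"
proof -
  define S where "S K r = (\<Sum>k\<in>K. \<theta> k * \<psi> k r)" for K r
  have \<psi>_sq: "\<psi> k \<in> square_integrable M" if "k \<ge> 1" for k
    using \<psi> that by (simp add: complete_orthonormal_basis_def Lp_2_eq_square_integrable)
  have S: "S K \<in> square_integrable M" if "K \<subseteq> {1..}" for K
    unfolding S_def[abs_def] real_scaleR_def[symmetric]
    using that by (intro square_integrable_sum square_integrable_scaleR \<psi>_sq) auto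
  have "(LINT r|M. (\<phi> r - S {1..n} r)\<^sup>2) \<le> 2 * (LINT r|M. (\<phi> r - S {1..m} r)\<^sup>2) + 2 * R * real n powr (- 2 * \<beta>)"
    if m: "m \<ge> n" for m
  proof -
    have split: "S {1..m} r = S {1..n} r + S {n<..m} r" for r
      unfolding S_def using m by (subst sum.union_disjoint[symmetric]) (auto intro!: sum.cong)
    have int: "integrable M (\<lambda>r. (\<phi> r - S {1..k} r)\<^sup>2)" for k
      using square_integrableD(2)[OF square_integrable_diff[OF \<phi> S[of "{1..k}"]]] by auto
    have "{n<..m} \<subseteq> {1..}" by auto
    from square_integrableD(2)[OF S[OF this]]
    have int': "integrable M (\<lambda>r. (S {n<..m} r)\<^sup>2)" by simp
    have "(LINT r|M. (\<phi> r - S {1..n} r)\<^sup>2) \<le> (LINT r|M. 2 * (\<phi> r - S {1..m} r)\<^sup>2 + 2 * (S {n<..m} r)\<^sup>2)"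
    proof (rule integral_mono)
      show "integrable M (\<lambda>r. (\<phi> r - S {1..n} r)\<^sup>2)"
        by (rule int)
      show "integrable M (\<lambda>r. 2 * (\<phi> r - S {1..m} r)\<^sup>2 + 2 * (S {n<..m} r)\<^sup>2)"
        using int int' by auto
      show "(\<phi> r - S {1..n} r)\<^sup>2 \<le> 2 * (\<phi> r - S {1..m} r)\<^sup>2 + 2 * (S {n<..m} r)\<^sup>2" for r
      proof -
        have "\<phi> r - S {1..n} r = (\<phi> r - S {1..m} r) + S {n<..m} r" using split[of r] by simp
        moreover have "(a + b)\<^sup>2 \<le> 2 * a\<^sup>2 + 2 * b\<^sup>2" for a b :: real
          using zero_le_power2[of "a - b"] by (simp add: power2_sum power2_diff)
        ultimately show ?thesis by metis
      qed
    qed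
    also have "\<dots> = 2 * (LINT r|M. (\<phi> r - S {1..m} r)\<^sup>2) + 2 * (LINT r|M. (S {n<..m} r)\<^sup>2)"
      using int int' by simp
    also have "(LINT r|M. (S {n<..m} r)\<^sup>2) = (\<Sum>k\<in>{n<..m}. (\<theta> k)\<^sup>2)"
      unfolding S_def using \<psi> by (intro orthonormal_sum_norm) auto
    also have "\<dots> \<le> (\<Sum>k\<in>{n<..m}. real n powr (- 2 * \<beta>) * (real k powr (2 * \<beta>) * (\<theta> k)\<^sup>2))"
    proof (intro sum_mono)
      fix k assume k: "k \<in> {n<..m}"
      have "real n powr (2 * \<beta>) \<le> real k powr (2 * \<beta>)"
        using k \<beta> n by (intro powr_mono2) auto
      then have "1 \<le> real n powr (- 2 * \<beta>) * real k powr (2 * \<beta>)"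
        using n by (simp add: powr_minus field_simps)
      from mult_right_mono[OF this, of "(\<theta> k)\<^sup>2"]
      show "(\<theta> k)\<^sup>2 \<le> real n powr (- 2 * \<beta>) * (real k powr (2 * \<beta>) * (\<theta> k)\<^sup>2)"
        by (simp add: mult_ac)
    qed
    also have "\<dots> \<le> real n powr (- 2 * \<beta>) * R"
      unfolding sum_distrib_left[symmetric] by (intro mult_left_mono energy) auto
    finally show ?thesis by (simp add: mult_ac)
  qed
  moreover have "(\<lambda>m. 2 * (LINT r|M. (\<phi> r - S {1..m} r)\<^sup>2) + 2 * R * real n powr (- 2 * \<beta>))
      \<longlonglongrightarrow> 2 * 0 + 2 * R * real n powr (- 2 * \<beta>)"
    using conv unfolding S_def by (intro tendsto_intros)
  ultimately have "(LINT r|M. (\<phi> r - S {1..n} r)\<^sup>2) \<le> 2 * 0 + 2 * R * real n powr (- 2 * \<beta>)"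
    by (intro LIMSEQ_le_const) auto
  then show ?thesis by (simp add: S_def)
qed

text \<open>
  The partial sums are bounded almost everywhere by \<open>C * (\<Sum>k. \<bar>\<theta> k\<bar> * k powr \<delta>)\<close>, which the energy bounds
  because \<open>k powr (2 * \<delta> - 2 * \<beta>)\<close> is summable. The bound passes to the \<open>L\<^sup>2\<close> limit \<open>\<phi>\<close>: the excess of
  \<open>\<bar>\<phi>\<bar>\<close> over it is dominated by the distance of \<open>\<phi>\<close> to each partial sum, hence vanishes in \<open>L\<^sup>2\<close>.
\<close>

lemma sobolev_sup_bound:
  assumes C: "C \<ge> 0" and sup: "\<And>k. k \<ge> 1 \<Longrightarrow> AE r in M. \<bar>\<psi> k r\<bar> \<le> C * real k powr \<delta>"
    and \<psi>: "\<And>k. k \<ge> 1 \<Longrightarrow> \<psi> k \<in> square_integrable M" and \<beta>: "\<beta> > \<delta> + 1 / 2"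
    and \<phi>: "\<phi> \<in> square_integrable M"
    and conv: "(\<lambda>n. LINT r|M. (\<phi> r - (\<Sum>k=1..n. \<theta> k * \<psi> k r))\<^sup>2) \<longlonglongrightarrow> 0"
    and energy: "\<And>K. finite K \<Longrightarrow> K \<subseteq> {1..} \<Longrightarrow> (\<Sum>k\<in>K. real k powr (2 * \<beta>) * (\<theta> k)\<^sup>2) \<le> R"
  shows "AE r in M. \<bar>\<phi> r\<bar> \<le> C * (R + (\<Sum>k. real k powr (2 * \<delta> - 2 * \<beta>)))"
proof -
  define Z where "Z = (\<Sum>k. real k powr (2 * \<delta> - 2 * \<beta>))"
  define B where "B = C * (R + Z)"
  define S where "S n r = (\<Sum>k=1..n. \<theta> k * \<psi> k r)" for n r
  have S: "S n \<in> square_integrable M" for n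
    unfolding S_def[abs_def] real_scaleR_def[symmetric]
    by (intro square_integrable_sum square_integrable_scaleR \<psi>) auto
  have summable: "summable (\<lambda>k. real k powr (2 * \<delta> - 2 * \<beta>))"
    using \<beta> by (simp add: summable_real_powr_iff)
  have coeff: "\<bar>\<theta> k\<bar> * real k powr \<delta> \<le> real k powr (2 * \<beta>) * (\<theta> k)\<^sup>2 + real k powr (2 * \<delta> - 2 * \<beta>)"
    if "k \<ge> 1" for k
  proof -
    \<comment> \<open>Geometric against arithmetic mean for the splitting
      \<open>k powr \<delta> * \<bar>\<theta> k\<bar> = (k powr \<beta> * \<bar>\<theta> k\<bar>) * k powr (\<delta> - \<beta>)\<close>.\<close>
    let ?a = "real k powr \<beta> * \<bar>\<theta> k\<bar>" and ?b = "real k powr (\<delta> - \<beta>)"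
    have "?a * ?b \<le> ?a\<^sup>2 + ?b\<^sup>2"
    proof -
      have "0 \<le> (?a - ?b)\<^sup>2" "0 \<le> ?a * ?b" by simp_all
      then show ?thesis unfolding power2_diff by linarith
    qed
    moreover have "?a * ?b = \<bar>\<theta> k\<bar> * real k powr \<delta>"
      using that by (simp add: powr_diff)
    moreover have "?a\<^sup>2 = real k powr (2 * \<beta>) * (\<theta> k)\<^sup>2" "?b\<^sup>2 = real k powr (2 * \<delta> - 2 * \<beta>)"
      using that by (simp_all add: power_mult_distrib powr_power algebra_simps)
    ultimately show ?thesis by simp
  qed
  have S_bound: "AE r in M. \<bar>S n r\<bar> \<le> B" for n
  proof -
    have "AE r in M. \<forall>k\<in>{1..n}. \<bar>\<psi> k r\<bar> \<le> C * real k powr \<delta>"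
      using sup by (intro AE_finite_allI) auto
    then show ?thesis
    proof eventually_elim
      case (elim r)
      have "\<bar>S n r\<bar> \<le> (\<Sum>k=1..n. \<bar>\<theta> k * \<psi> k r\<bar>)" unfolding S_def by (rule sum_abs)
      also have "\<dots> \<le> (\<Sum>k=1..n. C * (real k powr (2 * \<beta>) * (\<theta> k)\<^sup>2 + real k powr (2 * \<delta> - 2 * \<beta>)))"
      proof (intro sum_mono)
        fix k assume k: "k \<in> {1..n}"
        have "\<bar>\<theta> k * \<psi> k r\<bar> \<le> \<bar>\<theta> k\<bar> * (C * real k powr \<delta>)"
          using elim k unfolding abs_mult by (intro mult_left_mono) auto
        also have "\<dots> = C * (\<bar>\<theta> k\<bar> * real k powr \<delta>)" by simp
        also have "\<dots> \<le> C * (real k powr (2 * \<beta>) * (\<theta> k)\<^sup>2 + real k powr (2 * \<delta> - 2 * \<beta>))"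
          using k C coeff by (intro mult_left_mono) auto
        finally show "\<bar>\<theta> k * \<psi> k r\<bar> \<le> C * (real k powr (2 * \<beta>) * (\<theta> k)\<^sup>2 + real k powr (2 * \<delta> - 2 * \<beta>))" .
      qed
      also have "\<dots> = C * ((\<Sum>k=1..n. real k powr (2 * \<beta>) * (\<theta> k)\<^sup>2) + (\<Sum>k=1..n. real k powr (2 * \<delta> - 2 * \<beta>)))"
        by (simp flip: sum_distrib_left sum.distrib)
      also have "\<dots> \<le> B"
        unfolding B_def Z_def using C summable
        by (intro mult_left_mono add_mono energy sum_le_suminf) auto
      finally show ?case .
    qed
  qed
  define h where "h r = max 0 (\<bar>\<phi> r\<bar> - B)" for r
  note [measurable] = square_integrableD(1)[OF \<phi>] square_integrableD(1)[OF S]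
  have h_le: "AE r in M. (h r)\<^sup>2 \<le> (\<phi> r - S n r)\<^sup>2" for n
    using S_bound[of n]
  proof eventually_elim
    case (elim r)
    then have "\<bar>h r\<bar> \<le> \<bar>\<phi> r - S n r\<bar>" by (auto simp: h_def)
    then show ?case by (simp only: abs_le_square_iff)
  qed
  have int: "integrable M (\<lambda>r. (\<phi> r - S n r)\<^sup>2)" for n
    using square_integrableD(2)[OF square_integrable_diff[OF \<phi> S]] by auto
  have [measurable]: "h \<in> borel_measurable M" unfolding h_def by measurable
  have int_h: "integrable M (\<lambda>r. (h r)\<^sup>2)"
    by (rule Bochner_Integration.integrable_bound[OF int[of 0]]) (use h_le[of 0] in auto)
  have "(LINT r|M. (h r)\<^sup>2) \<le> 0"
  proof (rule LIMSEQ_le_const)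
    show "(\<lambda>n. LINT r|M. (\<phi> r - S n r)\<^sup>2) \<longlonglongrightarrow> 0" using conv by (simp add: S_def)
    show "\<exists>N. \<forall>n\<ge>N. (LINT r|M. (h r)\<^sup>2) \<le> (LINT r|M. (\<phi> r - S n r)\<^sup>2)"
      using int_h int h_le by (auto intro!: integral_mono_AE)
  qed
  moreover have "(LINT r|M. (h r)\<^sup>2) \<ge> 0" by simp
  ultimately have "AE r in M. (h r)\<^sup>2 = 0"
    using int_h by (subst integral_nonneg_eq_0_iff_AE[symmetric]) auto
  then have "AE r in M. \<bar>\<phi> r\<bar> \<le> B"
    by eventually_elim (auto simp: h_def max_def split: if_splits)
  then show ?thesis by (simp add: B_def Z_def)
qed

section \<open>The observed statistics\<close>

lemma vec_nth_Basis_integral: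
  fixes \<eta> :: "'w \<Rightarrow> (real^'d)^'n"
  assumes "\<And>i. integrable P (\<lambda>\<omega>. \<eta> \<omega> $ i)" and "b \<in> Basis"
  shows "integrable P (\<lambda>\<omega>. \<eta> \<omega> \<bullet> b)"
    and "(\<And>i. (LINT \<omega>|P. \<eta> \<omega> $ i) = 0) \<Longrightarrow> (LINT \<omega>|P. \<eta> \<omega> \<bullet> b) = 0"
proof -
  obtain i u where b: "b = axis i u" using assms(2) by (auto simp: Basis_vec_def)
  show "integrable P (\<lambda>\<omega>. \<eta> \<omega> \<bullet> b)"
    unfolding b inner_axis using assms(1) by simp
  show "(LINT \<omega>|P. \<eta> \<omega> \<bullet> b) = 0" if "\<And>i. (LINT \<omega>|P. \<eta> \<omega> $ i) = 0"
    unfolding b inner_axis using assms(1) that by (subst integral_inner_left) auto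
qed

definition statistic :: "(real \<Rightarrow> real) \<Rightarrow> ((real^'d)^'n) \<times> ((real^'d)^'n) \<Rightarrow> real" where
  "statistic e z = force e (fst z) \<bullet> snd z"

lemma statistic_measurable:
  assumes "zero_ext e \<in> borel_measurable borel"
  shows "statistic e \<in> borel_measurable (borel \<Otimes>\<^sub>M borel)"
proof -
  note [measurable] = force_measurable[OF assms]
  show ?thesis unfolding statistic_def by measurable
qed

definition coefficient :: "(real \<Rightarrow> real) \<Rightarrow> nat \<Rightarrow> (nat \<Rightarrow> ((real^'d)^'n) \<times> ((real^'d)^'n)) \<Rightarrow> real" where
  "coefficient e M D = (1 / real M) * (\<Sum>m=1..M. statistic e (D m))"

definition projection_estimator ::
  "(nat \<Rightarrow> real \<Rightarrow> real) \<Rightarrow> nat \<Rightarrow> nat \<Rightarrow> (nat \<Rightarrow> ((real^'d)^'n) \<times> ((real^'d)^'n)) \<Rightarrow> real \<Rightarrow> real" where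
  "projection_estimator e n M D r = (\<Sum>k=1..n. coefficient (e k) M D * e k r)"

locale observation_model = particle_system P X for P :: "'w measure" and X :: "'w \<Rightarrow> (real^'d)^'n" +
  fixes \<eta> :: "'w \<Rightarrow> (real^'d)^'n" and \<sigma> :: real
  assumes \<eta>_measurable [measurable]: "\<eta> \<in> borel_measurable P"
    and indep: "indep_var borel X borel \<eta>"
    and B1: "noise_B1 P \<eta> \<sigma>"
begin

lemma noise_integral:
  shows "integrable P (\<lambda>\<omega>. \<eta> \<omega> $ i)" "(LINT \<omega>|P. \<eta> \<omega> $ i) = 0"
    "\<eta> \<in> square_integrable P" "(LINT \<omega>|P. (norm (\<eta> \<omega>))\<^sup>2) = N * \<sigma>\<^sup>2"
  using B1 by (auto simp: noise_B1_def square_integrable_def norm_vec_squared[where 'n='n] integral_sum N_def)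

context
  fixes F :: "(real^'d)^'n \<Rightarrow> (real^'d)^'n"
  assumes F [measurable]: "F \<in> borel_measurable borel" and F_sq: "(\<lambda>\<omega>. F (X \<omega>)) \<in> square_integrable P"
begin

text \<open>
  Independence holds between \<open>X\<close> and \<open>\<eta>\<close> as vectors, so the inner product is split into coordinates, each
  a product of independent real variables of which the second is centred.
\<close>

lemma noise_inner_mean: "(LINT \<omega>|P. F (X \<omega>) \<bullet> \<eta> \<omega>) = 0"
proof -
  have component: "integrable P (\<lambda>\<omega>. (F (X \<omega>) \<bullet> b) * (\<eta> \<omega> \<bullet> b)) \<and> (LINT \<omega>|P. (F (X \<omega>) \<bullet> b) * (\<eta> \<omega> \<bullet> b)) = 0"
    if b: "b \<in> Basis" for b
  proof -
    have "indep_var borel ((\<lambda>x. F x \<bullet> b) \<circ> X) borel ((\<lambda>y. y \<bullet> b) \<circ> \<eta>)"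
      by (rule indep_var_compose[OF indep]) auto
    then have ind: "indep_var borel (\<lambda>\<omega>. F (X \<omega>) \<bullet> b) borel (\<lambda>\<omega>. \<eta> \<omega> \<bullet> b)" by (simp add: comp_def)
    have 1: "integrable P (\<lambda>\<omega>. F (X \<omega>) \<bullet> b)"
      using square_integrable_inner[OF F_sq, of "\<lambda>_. b"] by (simp add: square_integrable_def)
    show ?thesis
      using indep_var_integrable[OF ind 1] indep_var_lebesgue_integral[OF ind 1]
        vec_nth_Basis_integral[OF noise_integral(1) b] noise_integral(2) by simp
  qed
  have "(LINT \<omega>|P. F (X \<omega>) \<bullet> \<eta> \<omega>) = (LINT \<omega>|P. (\<Sum>b\<in>Basis. (F (X \<omega>) \<bullet> b) * (\<eta> \<omega> \<bullet> b)))"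
    by (intro Bochner_Integration.integral_cong refl euclidean_inner)
  also have "\<dots> = (\<Sum>b\<in>Basis. LINT \<omega>|P. (F (X \<omega>) \<bullet> b) * (\<eta> \<omega> \<bullet> b))"
    using component by (intro Bochner_Integration.integral_sum) auto
  also have "\<dots> = 0" using component by simp
  finally show ?thesis .
qed

lemma noise_product_norm:
  shows "integrable P (\<lambda>\<omega>. (norm (F (X \<omega>)))\<^sup>2 * (norm (\<eta> \<omega>))\<^sup>2)"
    and "(LINT \<omega>|P. (norm (F (X \<omega>)))\<^sup>2 * (norm (\<eta> \<omega>))\<^sup>2) = (LINT \<omega>|P. (norm (F (X \<omega>)))\<^sup>2) * (N * \<sigma>\<^sup>2)"
proof -
  have "indep_var borel ((\<lambda>x. (norm (F x))\<^sup>2) \<circ> X) borel ((\<lambda>y. (norm y)\<^sup>2) \<circ> \<eta>)"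
    by (rule indep_var_compose[OF indep]) auto
  then have ind: "indep_var borel (\<lambda>\<omega>. (norm (F (X \<omega>)))\<^sup>2) borel (\<lambda>\<omega>. (norm (\<eta> \<omega>))\<^sup>2)" by (simp add: comp_def)
  show "integrable P (\<lambda>\<omega>. (norm (F (X \<omega>)))\<^sup>2 * (norm (\<eta> \<omega>))\<^sup>2)"
    using indep_var_integrable[OF ind] F_sq noise_integral(3) by (auto dest: square_integrableD)
  show "(LINT \<omega>|P. (norm (F (X \<omega>)))\<^sup>2 * (norm (\<eta> \<omega>))\<^sup>2) = (LINT \<omega>|P. (norm (F (X \<omega>)))\<^sup>2) * (N * \<sigma>\<^sup>2)"
    using indep_var_lebesgue_integral[OF ind] F_sq noise_integral(3,4) by (auto dest: square_integrableD)
qed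

end

context
  fixes \<phi> :: "real \<Rightarrow> real" and B :: real
  assumes \<phi>: "\<phi> \<in> square_integrable \<mu>" and B: "B \<ge> 0" "AE r in \<mu>. \<bar>\<phi> r\<bar> \<le> B"
begin

lemma force_\<phi>_measurable [measurable]: "(force \<phi> :: (real^'d)^'n \<Rightarrow> _) \<in> borel_measurable borel"
  using zero_ext_f[OF \<phi>] by (rule force_measurable)

lemma observation_measurable [measurable]:
  "(\<lambda>\<omega>. (X \<omega>, force \<phi> (X \<omega>) + \<eta> \<omega>)) \<in> P \<rightarrow>\<^sub>M borel \<Otimes>\<^sub>M borel"
  by measurable

lemma prob_space_model_law: "prob_space (model_law P X \<eta> \<phi>)"
  unfolding model_law_def by (rule prob_space_distr) measurable

lemma sets_model_law [measurable_cong]: "sets (model_law P X \<eta> \<phi>) = sets (borel \<Otimes>\<^sub>M borel)"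
  by (simp add: model_law_def)

context
  fixes e :: "real \<Rightarrow> real"
  assumes e: "e \<in> square_integrable \<mu>"
begin

text \<open>
  The statistic observes without bias the inner product of the forces of \<open>e\<close> and of the true kernel,
  because the centred noise is averaged out.
\<close>

lemma statistic_mean:
  "(LINT z|model_law P X \<eta> \<phi>. statistic e z) = (LINT \<omega>|P. force e (X \<omega>) \<bullet> force \<phi> (X \<omega>))"
proof -
  note [measurable] = statistic_measurable[OF zero_ext_f[OF e]]
  have "(LINT z|model_law P X \<eta> \<phi>. statistic e z) = (LINT \<omega>|P. statistic e (X \<omega>, force \<phi> (X \<omega>) + \<eta> \<omega>))"
    unfolding model_law_def by (rule integral_distr) measurable
  also have "\<dots> = (LINT \<omega>|P. force e (X \<omega>) \<bullet> force \<phi> (X \<omega>) + force e (X \<omega>) \<bullet> \<eta> \<omega>)"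
    by (simp add: statistic_def inner_add_right)
  also have "\<dots> = (LINT \<omega>|P. force e (X \<omega>) \<bullet> force \<phi> (X \<omega>)) + (LINT \<omega>|P. force e (X \<omega>) \<bullet> \<eta> \<omega>)"
    using force_square_integrable[OF e] force_square_integrable[OF \<phi>] noise_integral(3)
    by (intro Bochner_Integration.integral_add square_integrable_inner)
  finally show ?thesis
    using noise_inner_mean[OF force_measurable[OF zero_ext_f[OF e]] force_square_integrable[OF e]] by simp
qed

text \<open>
  Cauchy--Schwarz puts the factor of \<open>e\<close> into \<open>norm (force e (X \<omega>))\<close> alone: the true force is bounded
  because the kernel is, and the noise is independent of \<open>X\<close> with finite variance. Only the
  second moment of the force of \<open>e\<close> enters, so the bound is uniform over normalised \<open>e\<close>.
\<close>

lemma statistic_square: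
  shows "statistic e \<in> square_integrable (model_law P X \<eta> \<phi>)"
    and "(LINT z|model_law P X \<eta> \<phi>. (statistic e z)\<^sup>2) \<le>
      2 * N * (B\<^sup>2 + \<sigma>\<^sup>2) * (LINT \<omega>|P. (norm (force e (X \<omega>)))\<^sup>2)"
proof -
  note [measurable] = force_measurable[OF zero_ext_f[OF e]] statistic_measurable[OF zero_ext_f[OF e]]
  let ?V = "\<lambda>\<omega>. force e (X \<omega>)" and ?W = "\<lambda>\<omega>. force \<phi> (X \<omega>)"
  let ?U = "\<lambda>\<omega>. 2 * (N * B\<^sup>2) * (norm (?V \<omega>))\<^sup>2 + 2 * ((norm (?V \<omega>))\<^sup>2 * (norm (\<eta> \<omega>))\<^sup>2)"
  have V: "integrable P (\<lambda>\<omega>. (norm (?V \<omega>))\<^sup>2)"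
    using force_square_integrable[OF e] by (rule square_integrableD)
  note noise = noise_product_norm[OF force_measurable[OF zero_ext_f[OF e]] force_square_integrable[OF e]]
  have U: "integrable P ?U" using V noise(1) by auto
  have bound: "AE \<omega> in P. (?V \<omega> \<bullet> (?W \<omega> + \<eta> \<omega>))\<^sup>2 \<le> ?U \<omega>"
    using force_AE_bounded[OF \<phi> B(2) B(1)]
  proof eventually_elim
    case (elim \<omega>)
    have "(?V \<omega> \<bullet> (?W \<omega> + \<eta> \<omega>))\<^sup>2 \<le> (norm (?V \<omega>))\<^sup>2 * (norm (?W \<omega> + \<eta> \<omega>))\<^sup>2"
      using Cauchy_Schwarz_ineq[of "?V \<omega>"] by (simp add: power2_norm_eq_inner)
    also have "\<dots> \<le> (norm (?V \<omega>))\<^sup>2 * (2 * (norm (?W \<omega>))\<^sup>2 + 2 * (norm (\<eta> \<omega>))\<^sup>2)"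
    proof (rule mult_left_mono)
      have "0 \<le> (norm (?W \<omega> - \<eta> \<omega>))\<^sup>2" by simp
      then show "(norm (?W \<omega> + \<eta> \<omega>))\<^sup>2 \<le> 2 * (norm (?W \<omega>))\<^sup>2 + 2 * (norm (\<eta> \<omega>))\<^sup>2"
        by (simp add: power2_norm_eq_inner inner_add_left inner_add_right inner_diff_left inner_diff_right inner_commute)
    qed simp
    also have "\<dots> \<le> (norm (?V \<omega>))\<^sup>2 * (2 * (N * B\<^sup>2) + 2 * (norm (\<eta> \<omega>))\<^sup>2)"
      using elim by (intro mult_left_mono add_mono) auto
    also have "\<dots> = ?U \<omega>" by (simp add: algebra_simps)
    finally show ?case .
  qed
  have int: "integrable P (\<lambda>\<omega>. (?V \<omega> \<bullet> (?W \<omega> + \<eta> \<omega>))\<^sup>2)"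
    by (rule Bochner_Integration.integrable_bound[OF U]) (use bound in auto)
  have "integrable (model_law P X \<eta> \<phi>) (\<lambda>z. (statistic e z)\<^sup>2)"
    unfolding model_law_def using int by (subst integrable_distr_eq) (auto simp: statistic_def)
  then show "statistic e \<in> square_integrable (model_law P X \<eta> \<phi>)"
    unfolding square_integrable_def by (auto cong: measurable_cong_sets)
  have "(LINT z|model_law P X \<eta> \<phi>. (statistic e z)\<^sup>2) = (LINT \<omega>|P. (?V \<omega> \<bullet> (?W \<omega> + \<eta> \<omega>))\<^sup>2)"
    unfolding model_law_def by (subst integral_distr) (auto simp: statistic_def)
  also have "\<dots> \<le> (LINT \<omega>|P. ?U \<omega>)"
    using int U bound by (rule integral_mono_AE)
  also have "\<dots> = 2 * N * (B\<^sup>2 + \<sigma>\<^sup>2) * (LINT \<omega>|P. (norm (?V \<omega>))\<^sup>2)"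
    using V noise by (simp add: algebra_simps)
  finally show "(LINT z|model_law P X \<eta> \<phi>. (statistic e z)\<^sup>2) \<le>
      2 * N * (B\<^sup>2 + \<sigma>\<^sup>2) * (LINT \<omega>|P. (norm (force e (X \<omega>)))\<^sup>2)" .
qed

end

end

section \<open>The projection estimator\<close>

context
  fixes e :: "nat \<Rightarrow> real \<Rightarrow> real" and n :: nat
  assumes e: "\<And>k. k \<in> {1..n} \<Longrightarrow> e k \<in> square_integrable \<mu>"
    and orth: "\<And>k l. k \<in> {1..n} \<Longrightarrow> l \<in> {1..n} \<Longrightarrow>
      (LINT \<omega>|P. force (e k) (X \<omega>) \<bullet> force (e l) (X \<omega>)) = (if k = l then 1 else 0)"
begin

lemma coefficient_measurable:
  assumes k: "k \<in> {1..n}"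
  shows "(coefficient (e k) M :: (nat \<Rightarrow> ((real^'d)^'n) \<times> ((real^'d)^'n)) \<Rightarrow> real)
    \<in> borel_measurable (PiM {1..M} (\<lambda>_. borel \<Otimes>\<^sub>M borel))"
proof -
  have "(\<lambda>D :: nat \<Rightarrow> ((real^'d)^'n) \<times> ((real^'d)^'n). statistic (e k) (D m))
      \<in> borel_measurable (PiM {1..M} (\<lambda>_. borel \<Otimes>\<^sub>M borel))" if "m \<in> {1..M}" for m
    by (rule measurable_compose[OF measurable_component_singleton[OF that] statistic_measurable[OF zero_ext_f[OF e[OF k]]]])
  then show ?thesis
    unfolding coefficient_def by (intro borel_measurable_times borel_measurable_const borel_measurable_sum)
qed

lemma combination_square_integrable: "(\<lambda>r. \<Sum>k=1..n. y k * e k r) \<in> square_integrable \<mu>"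
  unfolding real_scaleR_def[symmetric] by (intro square_integrable_sum square_integrable_scaleR e)

lemma projection_estimator_in_estimators:
  "(projection_estimator e n M :: (nat \<Rightarrow> ((real^'d)^'n) \<times> ((real^'d)^'n)) \<Rightarrow> _) \<in> estimators \<mu> M"
proof -
  have "(\<lambda>(D :: nat \<Rightarrow> ((real^'d)^'n) \<times> ((real^'d)^'n), r). projection_estimator e n M D r) \<in>
      borel_measurable (PiM {1..M} (\<lambda>_. borel \<Otimes>\<^sub>M borel) \<Otimes>\<^sub>M \<mu>)"
    unfolding projection_estimator_def case_prod_beta
  proof (intro borel_measurable_sum borel_measurable_times)
    fix k assume k: "k \<in> {1..n}"
    show "(\<lambda>z :: (nat \<Rightarrow> ((real^'d)^'n) \<times> ((real^'d)^'n)) \<times> real. coefficient (e k) M (fst z)) \<in> borel_measurable (PiM {1..M} (\<lambda>_. borel \<Otimes>\<^sub>M borel) \<Otimes>\<^sub>M \<mu>)"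
      by (rule measurable_compose[OF measurable_fst coefficient_measurable[OF k]])
    show "(\<lambda>z :: (nat \<Rightarrow> ((real^'d)^'n) \<times> ((real^'d)^'n)) \<times> real. e k (snd z)) \<in> borel_measurable (PiM {1..M} (\<lambda>_. borel \<Otimes>\<^sub>M borel) \<Otimes>\<^sub>M \<mu>)"
      by (rule measurable_compose[OF measurable_snd square_integrableD(1)[OF e[OF k]]])
  qed
  moreover have "projection_estimator e n M D \<in> Lp \<mu> 2" for D :: "nat \<Rightarrow> ((real^'d)^'n) \<times> ((real^'d)^'n)"
    unfolding Lp_2_eq_square_integrable projection_estimator_def by (rule combination_square_integrable)
  ultimately show ?thesis by (simp add: estimators_def)
qed

text \<open>
  Pythagoras for the forces, compared with the norm of \<open>L\<^sup>2\<close> by coercivity on the left and by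
  boundedness on the right. The comparison combination \<open>y\<close> is free; it will be the truncated basis
  expansion of \<open>\<phi>\<close>.
\<close>

lemma projection_error:
  assumes \<phi>: "\<phi> \<in> square_integrable \<mu>"
  shows "(LINT r|\<mu>. ((\<Sum>k=1..n. a k * e k r) - \<phi> r)\<^sup>2) \<le>
    (\<Sum>k=1..n. (a k - (LINT \<omega>|P. force (e k) (X \<omega>) \<bullet> force \<phi> (X \<omega>)))\<^sup>2) +
    N * (LINT r|\<mu>. ((\<Sum>k=1..n. y k * e k r) - \<phi> r)\<^sup>2)"
proof -
  let ?c = "\<lambda>k. LINT \<omega>|P. force (e k) (X \<omega>) \<bullet> force \<phi> (X \<omega>)"
  let ?d = "(LINT \<omega>|P. (norm (force \<phi> (X \<omega>)))\<^sup>2) - (\<Sum>k=1..n. (?c k)\<^sup>2)"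
  let ?g = "\<lambda>a r. (\<Sum>k=1..n. a k * e k r) - \<phi> r"
  have g: "?g a \<in> square_integrable \<mu>" for a
    by (intro square_integrable_diff combination_square_integrable \<phi>)
  have error: "(LINT \<omega>|P. (norm (force (?g a) (X \<omega>)))\<^sup>2) = (\<Sum>k=1..n. (a k - ?c k)\<^sup>2) + ?d" for a
    unfolding force_diff force_sum
    by (rule orthonormal_expansion_error[OF _ force_square_integrable[OF e] orth force_square_integrable[OF \<phi>]]) auto
  have "0 \<le> (\<Sum>k=1..n. (y k - ?c k)\<^sup>2)" by (intro sum_nonneg) auto
  then have d: "?d \<le> N * (LINT r|\<mu>. (?g y r)\<^sup>2)"
    using error[of y] force_bounded[OF g[of y]] by linarith
  have "1 \<le> N / (N - 1)" using N_ge by simp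
  then have "1 * (LINT r|\<mu>. (?g a r)\<^sup>2) \<le> N / (N - 1) * (LINT r|\<mu>. (?g a r)\<^sup>2)"
    by (intro mult_right_mono) auto
  also have "\<dots> \<le> (\<Sum>k=1..n. (a k - ?c k)\<^sup>2) + ?d"
    using force_coercive[OF g[of a]] unfolding error .
  finally show ?thesis using d by simp
qed

text \<open>
  Variance plus squared bias: each of the \<open>n\<close> coefficients contributes the variance of a sample mean of a
  statistic whose second moment is bounded independently of \<open>k\<close> and \<open>M\<close>.
\<close>

lemma projection_estimator_risk:
  assumes M: "M \<ge> 1" and \<phi>: "\<phi> \<in> square_integrable \<mu>" and B: "B \<ge> 0" "AE r in \<mu>. \<bar>\<phi> r\<bar> \<le> B"
  shows "scaled_risk P X \<eta> \<mu> \<beta> M (projection_estimator e n M) \<phi> \<le>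
    ennreal (real M powr (2 * \<beta> / (2 * \<beta> + 1)) *
      (real n * (2 * N * (B\<^sup>2 + \<sigma>\<^sup>2)) / real M + N * (LINT r|\<mu>. ((\<Sum>k=1..n. y k * e k r) - \<phi> r)\<^sup>2)))"
proof -
  define s where "s = real M powr (2 * \<beta> / (2 * \<beta> + 1))"
  have s: "s \<ge> 0" by (simp add: s_def)
  define b where "b = N * (LINT r|\<mu>. ((\<Sum>k=1..n. y k * e k r) - \<phi> r)\<^sup>2)"
  have b: "b \<ge> 0" using N_ge by (simp add: b_def)
  let ?c = "\<lambda>k. LINT \<omega>|P. force (e k) (X \<omega>) \<bullet> force \<phi> (X \<omega>)"
  let ?Q = "model_law P X \<eta> \<phi>"
  interpret D: prob_space "data_law P X \<eta> M \<phi>"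
    unfolding data_law_def by (intro prob_space_PiM prob_space_model_law[OF \<phi> B])
  define v where "v k D = (coefficient (e k) M D - ?c k)\<^sup>2" for k and D :: "nat \<Rightarrow> ((real^'d)^'n) \<times> ((real^'d)^'n)"
  have v_nonneg: "0 \<le> v k D" for k D by (simp add: v_def)
  have v: "integrable (data_law P X \<eta> M \<phi>) (v k)"
      "(LINT D|data_law P X \<eta> M \<phi>. v k D) \<le> 2 * N * (B\<^sup>2 + \<sigma>\<^sup>2) / real M" if k: "k \<in> {1..n}" for k
  proof -
    note var = PiM_sample_mean_variance[OF prob_space_model_law[OF \<phi> B] statistic_square(1)[OF \<phi> B e[OF k]] M
      statistic_mean[OF \<phi> B e[OF k], symmetric]]
    show "integrable (data_law P X \<eta> M \<phi>) (v k)"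
      using var(1) by (simp add: v_def[abs_def] data_law_def coefficient_def)
    have "(LINT D|data_law P X \<eta> M \<phi>. v k D) \<le> (LINT z|?Q. (statistic (e k) z)\<^sup>2) / real M"
      using var(2) by (simp add: v_def data_law_def coefficient_def)
    also have "(LINT z|?Q. (statistic (e k) z)\<^sup>2) \<le> 2 * N * (B\<^sup>2 + \<sigma>\<^sup>2)"
      using statistic_square(2)[OF \<phi> B e[OF k]] orth[OF k k] by (simp add: power2_norm_eq_inner)
    finally show "(LINT D|data_law P X \<eta> M \<phi>. v k D) \<le> 2 * N * (B\<^sup>2 + \<sigma>\<^sup>2) / real M"
      by (simp add: divide_right_mono)
  qed
  have "scaled_risk P X \<eta> \<mu> \<beta> M (projection_estimator e n M) \<phi> \<le>
      (\<integral>\<^sup>+D. ennreal (s * ((\<Sum>k=1..n. v k D) + b)) \<partial>data_law P X \<eta> M \<phi>)"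
    unfolding scaled_risk_def s_def[symmetric]
  proof (intro nn_integral_mono ennreal_leI mult_left_mono s)
    show "(Lp_norm \<mu> 2 (\<lambda>r. projection_estimator e n M D r - \<phi> r))\<^sup>2 \<le> (\<Sum>k=1..n. v k D) + b" for D
      unfolding Lp_norm_2_squared projection_estimator_def v_def b_def by (rule projection_error[OF \<phi>])
  qed
  also have "\<dots> = ennreal (LINT D|data_law P X \<eta> M \<phi>. s * ((\<Sum>k=1..n. v k D) + b))"
    using v(1) s b
    by (intro nn_integral_eq_integral integrable_mult_right Bochner_Integration.integrable_add Bochner_Integration.integrable_sum)
      (auto intro!: AE_I2 mult_nonneg_nonneg add_nonneg_nonneg sum_nonneg v_nonneg)
  also have "(LINT D|data_law P X \<eta> M \<phi>. s * ((\<Sum>k=1..n. v k D) + b)) =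
      s * ((\<Sum>k=1..n. LINT D|data_law P X \<eta> M \<phi>. v k D) + b)"
  proof -
    have "integrable (data_law P X \<eta> M \<phi>) (\<lambda>D. \<Sum>k=1..n. v k D)"
      by (intro Bochner_Integration.integrable_sum v(1))
    moreover have "(LINT D|data_law P X \<eta> M \<phi>. (\<Sum>k=1..n. v k D)) = (\<Sum>k=1..n. LINT D|data_law P X \<eta> M \<phi>. v k D)"
      by (intro Bochner_Integration.integral_sum v(1))
    ultimately show ?thesis by (simp add: D.prob_space)
  qed
  also have "\<dots> \<le> s * ((\<Sum>k=1..n. 2 * N * (B\<^sup>2 + \<sigma>\<^sup>2) / real M) + b)"
    using v(2) s by (intro mult_left_mono add_right_mono sum_mono) auto
  finally show ?thesis by (simp add: s_def b_def ennreal_leI)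
qed

end

text \<open>
  Coercivity turns linear independence of the basis functions into positive definiteness of the Gram
  matrix of their forces.
\<close>

lemma orthonormal_forces_exist:
  assumes \<psi>: "complete_orthonormal_basis \<mu> \<psi>"
  obtains e where "\<And>k. e k \<in> square_integrable \<mu>"
    and "\<And>k l. k \<in> {1..n} \<Longrightarrow> l \<in> {1..n} \<Longrightarrow>
      (LINT \<omega>|P. force (e k) (X \<omega>) \<bullet> force (e l) (X \<omega>)) = (if k = l then 1 else 0)"
    and "\<And>\<theta>. \<exists>y. \<forall>r. (\<Sum>k=1..n. \<theta> k * \<psi> k r) = (\<Sum>k=1..n. y k * e k r)"
proof -
  have \<psi>_sq: "\<psi> k \<in> square_integrable \<mu>" if "k \<in> {1..n}" for k
    using \<psi> that by (simp add: complete_orthonormal_basis_def Lp_2_eq_square_integrable)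
  define A where "A p q = (LINT \<omega>|P. force (\<psi> p) (X \<omega>) \<bullet> force (\<psi> q) (X \<omega>))" for p q
  have comb: "(\<lambda>r. \<Sum>k=1..n. x k * \<psi> k r) \<in> square_integrable \<mu>" for x
    unfolding real_scaleR_def[symmetric] by (intro square_integrable_sum square_integrable_scaleR \<psi>_sq)
  have pos: "0 < (\<Sum>p=1..n. \<Sum>q=1..n. x p * x q * A p q)" if x: "\<exists>k\<in>{1..n}. x k \<noteq> 0" for x
  proof -
    have "(LINT r|\<mu>. (\<Sum>k=1..n. x k * \<psi> k r)\<^sup>2) = (\<Sum>k=1..n. (x k)\<^sup>2)"
      using \<psi> by (intro orthonormal_sum_norm) auto
    also have "\<dots> > 0" using x by (auto intro: sum_pos2)
    finally have "0 < N / (N - 1) * (LINT r|\<mu>. (\<Sum>k=1..n. x k * \<psi> k r)\<^sup>2)"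
      using N_ge by simp
    also have "\<dots> \<le> (LINT \<omega>|P. (norm (force (\<lambda>r. \<Sum>k=1..n. x k * \<psi> k r) (X \<omega>)))\<^sup>2)"
      by (rule force_coercive[OF comb])
    also have "\<dots> = (\<Sum>p=1..n. \<Sum>q=1..n. x p * x q * A p q)"
      unfolding force_sum A_def by (intro integral_norm_sum_squared force_square_integrable \<psi>_sq)
    finally show ?thesis .
  qed
  obtain G where G: "\<forall>k\<in>{1..n}. \<forall>l\<in>{1..n}. (\<Sum>p=1..n. \<Sum>q=1..n. G k p * G l q * A p q) = (if k = l then 1 else 0)"
    and span: "\<forall>x. \<exists>y. \<forall>p\<in>{1..n}. x p = (\<Sum>k=1..n. y k * G k p)"
    using gram_schmidt_coefficients[of "{1..n}" A] pos by (auto simp: A_def inner_commute)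
  define e where "e k r = (\<Sum>p=1..n. G k p * \<psi> p r)" for k r
  show ?thesis
  proof
    show "e k \<in> square_integrable \<mu>" for k
      unfolding e_def[abs_def] by (rule comb)
    show "(LINT \<omega>|P. force (e k) (X \<omega>) \<bullet> force (e l) (X \<omega>)) = (if k = l then 1 else 0)"
      if kl: "k \<in> {1..n}" "l \<in> {1..n}" for k l
    proof -
      have inner: "integrable P (\<lambda>\<omega>. force (\<psi> p) (X \<omega>) \<bullet> force (\<psi> q) (X \<omega>))" if "p \<in> {1..n}" "q \<in> {1..n}" for p q
        using that by (intro square_integrable_inner force_square_integrable \<psi>_sq)
      have "(LINT \<omega>|P. force (e k) (X \<omega>) \<bullet> force (e l) (X \<omega>)) =
        (LINT \<omega>|P. (\<Sum>p=1..n. \<Sum>q=1..n. G k p * G l q * (force (\<psi> p) (X \<omega>) \<bullet> force (\<psi> q) (X \<omega>))))"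
        unfolding e_def[abs_def] force_sum inner_sum_left inner_sum_right inner_scaleR_left inner_scaleR_right
        by (intro Bochner_Integration.integral_cong refl)
          (simp add: sum_distrib_left mult_ac, subst sum.swap, simp add: mult_ac)
      also have "\<dots> = (\<Sum>p=1..n. (LINT \<omega>|P. (\<Sum>q=1..n. G k p * G l q * (force (\<psi> p) (X \<omega>) \<bullet> force (\<psi> q) (X \<omega>)))))"
        by (intro Bochner_Integration.integral_sum Bochner_Integration.integrable_sum integrable_mult_right inner)
      also have "\<dots> = (\<Sum>p=1..n. \<Sum>q=1..n. G k p * G l q * A p q)"
        unfolding A_def integral_mult_right_zero[symmetric]
        by (intro sum.cong refl Bochner_Integration.integral_sum integrable_mult_right inner)
      finally show ?thesis using G kl by simp
    qed
    show "\<exists>y. \<forall>r. (\<Sum>k=1..n. \<theta> k * \<psi> k r) = (\<Sum>k=1..n. y k * e k r)" for \<theta>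
    proof -
      obtain y where y: "\<forall>p\<in>{1..n}. \<theta> p = (\<Sum>k=1..n. y k * G k p)" using span by blast
      have "(\<Sum>p=1..n. \<theta> p * \<psi> p r) = (\<Sum>k=1..n. y k * e k r)" for r
      proof -
        have "(\<Sum>p=1..n. \<theta> p * \<psi> p r) = (\<Sum>p=1..n. \<Sum>k=1..n. y k * G k p * \<psi> p r)"
          using y by (intro sum.cong refl) (simp add: sum_distrib_right)
        also have "\<dots> = (\<Sum>k=1..n. \<Sum>p=1..n. y k * G k p * \<psi> p r)" by (rule sum.swap)
        finally show ?thesis by (simp add: e_def sum_distrib_left mult_ac)
      qed
      then show ?thesis by blast
    qed
  qed
qed

end

section \<open>The minimax rate\<close>

text \<open>
  With \<open>t = M powr (1 / (2 * \<beta> + 1))\<close> the scaling factor is \<open>s = t powr (2 * \<beta>) = M / t\<close>, so the dimension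
  \<open>n \<approx> t\<close> makes both the scaled variance and the scaled squared bias bounded. Rounding up costs at most a
  factor \<open>2\<close>, as \<open>t \<ge> 1\<close>.
\<close>

lemma powr_rate_balance:
  fixes M :: nat
  assumes M: "M \<ge> 1" and \<beta>: "\<beta> > 0"
  defines "s \<equiv> real M powr (2 * \<beta> / (2 * \<beta> + 1))" and "n \<equiv> nat \<lceil>real M powr (1 / (2 * \<beta> + 1))\<rceil>"
  shows "n \<ge> 1" "s * (real n / real M) \<le> 2" "s * real n powr (- 2 * \<beta>) \<le> 1"
proof -
  define t where "t = real M powr (1 / (2 * \<beta> + 1))"
  have t: "t \<ge> 1" using M \<beta> unfolding t_def by (intro ge_one_powr_ge_zero) auto
  have n: "real n \<ge> t" "real n \<le> t + 1"
    using t by (auto simp: n_def t_def[symmetric])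
  show "n \<ge> 1" using n t by linarith
  have s_t: "s = t powr (2 * \<beta>)" by (simp add: s_def t_def powr_powr)
  have "2 * \<beta> / (2 * \<beta> + 1) + 1 / (2 * \<beta> + 1) = 1"
    using \<beta> by (simp add: add_divide_distrib[symmetric])
  then have st: "s * t = real M"
    using M by (simp add: s_def t_def powr_add[symmetric])
  have "s * (real n / real M) \<le> s * (2 * t / real M)"
    using n t by (intro mult_left_mono divide_right_mono) (auto simp: s_def)
  also have "\<dots> = 2" using st M by (simp add: field_simps)
  finally show "s * (real n / real M) \<le> 2" .
  have "real n powr (- 2 * \<beta>) \<le> t powr (- 2 * \<beta>)"
    using n t \<beta> by (intro powr_mono2') auto
  then have "s * real n powr (- 2 * \<beta>) \<le> s * t powr (- 2 * \<beta>)"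
    by (intro mult_left_mono) (auto simp: s_def)
  also have "\<dots> = 1" using t by (simp add: s_t powr_add[symmetric])
  finally show "s * real n powr (- 2 * \<beta>) \<le> 1" .
qed

theorem theorem3p13:
  fixes P :: "'w measure"
    and X \<eta> :: "'w \<Rightarrow> (real^'d)^'n"
    and \<rho>' :: "real \<Rightarrow> real"
    and \<psi> :: "nat \<Rightarrow> real \<Rightarrow> real"
    and \<sigma> \<delta> C\<^sub>\<delta> Lt L \<beta> :: real
  defines "\<mu> \<equiv> on_unit (exploration P X)"
  assumes "CARD('n) \<ge> 3"
    and "prob_space P"
    and "X \<in> borel_measurable P" and "\<eta> \<in> borel_measurable P"
    and "prob_space.indep_var P borel X borel \<eta>"
    and "exchangeable_A1 P X" and "cond_indep_A2 P X" and "continuous_density_A3 P X"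
    and "noise_B1 P \<eta> \<sigma>"
    and "has_continuous_density (exploration P X) \<rho>'" and "{0..1} \<subseteq> supp \<rho>'"
    and "complete_orthonormal_basis \<mu> \<psi>"
    and "\<delta> \<ge> 0" and "C\<^sub>\<delta> > 0"
    and "\<forall>k\<ge>1. \<psi> k \<in> Lp \<mu> 4" and "(SUP k\<in>{1..}. ereal (Lp_norm \<mu> 4 (\<psi> k))) \<le> ereal Lt"
    and "\<forall>n\<ge>1. (SUP k\<in>{1..n}. Linf_norm \<mu> (\<psi> k)) \<le> ereal (C\<^sub>\<delta> * real n powr \<delta>)"
    and "L > 0" and "\<beta> > \<delta> + 1 / 2"
  shows "\<exists>C_upper > 0.
    limsup (\<lambda>M. INF est\<in>estimators \<mu> M. SUP \<phi>\<in>sobolev_class \<mu> \<psi> \<beta> L.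
      scaled_risk P X \<eta> \<mu> \<beta> M est \<phi>) \<le> ennreal C_upper"
proof -
  interpret prob_space P by fact
  \<comment> \<open>The exploration measure has a density, so single distances are null.\<close>
  have no_collision: "emeasure (exploration P X) {0} = 0"
  proof -
    have \<rho>: "exploration P X = density lborel (\<lambda>r. ennreal (indicator {0..} r * \<rho>' r))"
        and cont: "continuous_on {0..} \<rho>'"
      using assms(11) by (auto simp: has_continuous_density_def)
    have meas: "(\<lambda>r. ennreal (indicator {0..} r * \<rho>' r)) \<in> borel_measurable lborel"
      using borel_measurable_continuous_on_indicator[OF _ cont] by simp
    have "emeasure (density lborel (\<lambda>r. ennreal (indicator {0..} r * \<rho>' r))) {0} =
        (\<integral>\<^sup>+r. ennreal (indicator {0..} r * \<rho>' r) * indicator {0} r \<partial>lborel)"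
      by (rule emeasure_density[OF meas]) simp
    also have "\<dots> = 0"
      by (subst nn_integral_0_iff_AE) (use meas AE_lborel_singleton[of "0::real"] in \<open>auto elim!: eventually_mono\<close>)
    finally show ?thesis unfolding \<rho> .
  qed
  interpret S: observation_model P X \<eta> \<sigma>
    using assms no_collision by unfold_locales auto
  have \<mu>: "S.\<mu> = \<mu>" by (simp add: S.\<mu>_def \<mu>_def)
  have \<beta>: "\<beta> > 0" using assms by linarith
  have basis: "complete_orthonormal_basis \<mu> \<psi>" by fact
  have \<psi>_sq: "\<psi> k \<in> square_integrable \<mu>" if "k \<ge> 1" for k
    using basis that by (simp add: complete_orthonormal_basis_def Lp_2_eq_square_integrable)
  have sup: "AE r in \<mu>. \<bar>\<psi> k r\<bar> \<le> C\<^sub>\<delta> * real k powr \<delta>" if k: "k \<ge> 1" for k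
  proof -
    have "Linf_norm \<mu> (\<psi> k) \<le> (SUP k\<in>{1..k}. Linf_norm \<mu> (\<psi> k))" using k by (intro SUP_upper) auto
    also have "\<dots> \<le> ereal (C\<^sub>\<delta> * real k powr \<delta>)" using assms k by blast
    finally have le: "Linf_norm \<mu> (\<psi> k) \<le> ereal (C\<^sub>\<delta> * real k powr \<delta>)" .
    have "AE r in \<mu>. ereal \<bar>\<psi> k r\<bar> \<le> Linf_norm \<mu> (\<psi> k)"
      unfolding Linf_norm_def by (rule esssup_AE)
    then show ?thesis
      by eventually_elim (use le order_trans in fastforce)
  qed
  \<comment> \<open>\<open>R\<close> is the energy budget of the class and \<open>B\<close> the common sup bound of its members.\<close>
  define R where "R = L\<^sup>2 / pi powr (2 * \<beta>)"
  define B where "B = C\<^sub>\<delta> * (R + (\<Sum>k. real k powr (2 * \<delta> - 2 * \<beta>)))"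
  have R: "R \<ge> 0" by (simp add: R_def)
  have B: "B \<ge> 0"
    unfolding B_def using R assms by (intro mult_nonneg_nonneg add_nonneg_nonneg suminf_nonneg) (auto simp: summable_real_powr_iff)
  define C where "C = 4 * S.N * (B\<^sup>2 + \<sigma>\<^sup>2) + 2 * S.N * R"
  have C: "C \<ge> 0" using R S.N_ge by (simp add: C_def)
  have "(INF est\<in>estimators \<mu> M. SUP \<phi>\<in>sobolev_class \<mu> \<psi> \<beta> L. scaled_risk P X \<eta> \<mu> \<beta> M est \<phi>) \<le> ennreal (C + 1)"
    if M: "M \<ge> 1" for M
  proof -
    define s where "s = real M powr (2 * \<beta> / (2 * \<beta> + 1))"
    define n where "n = nat \<lceil>real M powr (1 / (2 * \<beta> + 1))\<rceil>"
    note rate = powr_rate_balance[OF M \<beta>, folded s_def n_def]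
    obtain e where e: "\<And>k. e k \<in> square_integrable \<mu>"
      and orth: "\<And>k l. k \<in> {1..n} \<Longrightarrow> l \<in> {1..n} \<Longrightarrow>
        (LINT \<omega>|P. force (e k) (X \<omega>) \<bullet> force (e l) (X \<omega>)) = (if k = l then 1 else 0)"
      and span: "\<And>\<theta>. \<exists>y. \<forall>r. (\<Sum>k=1..n. \<theta> k * \<psi> k r) = (\<Sum>k=1..n. y k * e k r)"
      using that by (rule S.orthonormal_forces_exist[unfolded \<mu>, OF basis, of n])
    have "scaled_risk P X \<eta> \<mu> \<beta> M (projection_estimator e n M) \<phi> \<le> ennreal (C + 1)"
      if \<phi>: "\<phi> \<in> sobolev_class \<mu> \<psi> \<beta> L" for \<phi>
    proof -
      obtain \<theta> where \<phi>_sq: "\<phi> \<in> square_integrable \<mu>"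
        and conv: "(\<lambda>n. LINT r|\<mu>. (\<phi> r - (\<Sum>k=1..n. \<theta> k * \<psi> k r))\<^sup>2) \<longlonglongrightarrow> 0"
        and energy: "\<And>K. finite K \<Longrightarrow> K \<subseteq> {1..} \<Longrightarrow> (\<Sum>k\<in>K. real k powr (2 * \<beta>) * (\<theta> k)\<^sup>2) \<le> R"
        using that unfolding R_def by (rule sobolev_classE[OF \<phi>])
      have bounded: "AE r in \<mu>. \<bar>\<phi> r\<bar> \<le> B"
        unfolding B_def
        by (rule sobolev_sup_bound[OF _ sup \<psi>_sq _ \<phi>_sq conv energy]) (use assms in auto)
      have tail: "(LINT r|\<mu>. (\<phi> r - (\<Sum>k=1..n. \<theta> k * \<psi> k r))\<^sup>2) \<le> 2 * R * real n powr (- 2 * \<beta>)"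
        by (rule sobolev_tail_bound[OF basis _ rate(1) \<phi>_sq conv energy]) (use \<beta> in auto)
      obtain y where y: "\<And>r. (\<Sum>k=1..n. \<theta> k * \<psi> k r) = (\<Sum>k=1..n. y k * e k r)" using span by blast
      have "scaled_risk P X \<eta> \<mu> \<beta> M (projection_estimator e n M) \<phi> \<le>
        ennreal (s * (real n * (2 * S.N * (B\<^sup>2 + \<sigma>\<^sup>2)) / real M + S.N * (LINT r|\<mu>. ((\<Sum>k=1..n. y k * e k r) - \<phi> r)\<^sup>2)))"
        unfolding s_def by (rule S.projection_estimator_risk[unfolded \<mu>, OF e orth M \<phi>_sq B bounded])
      also have "\<dots> \<le> ennreal (C + 1)"
      proof (rule ennreal_leI)
        have "(LINT r|\<mu>. ((\<Sum>k=1..n. y k * e k r) - \<phi> r)\<^sup>2) \<le> 2 * R * real n powr (- 2 * \<beta>)"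
          using tail unfolding y by (simp add: power2_commute)
        then have "s * (real n * (2 * S.N * (B\<^sup>2 + \<sigma>\<^sup>2)) / real M + S.N * (LINT r|\<mu>. ((\<Sum>k=1..n. y k * e k r) - \<phi> r)\<^sup>2)) \<le>
          s * (real n * (2 * S.N * (B\<^sup>2 + \<sigma>\<^sup>2)) / real M + S.N * (2 * R * real n powr (- 2 * \<beta>)))"
          using S.N_ge by (intro mult_left_mono add_left_mono) (auto simp: s_def)
        also have "\<dots> = 2 * S.N * (B\<^sup>2 + \<sigma>\<^sup>2) * (s * (real n / real M)) + 2 * S.N * R * (s * real n powr (- 2 * \<beta>))"
          by (simp add: algebra_simps add_divide_distrib)
        also have "\<dots> \<le> 2 * S.N * (B\<^sup>2 + \<sigma>\<^sup>2) * 2 + 2 * S.N * R * 1"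
          using rate S.N_ge R by (intro add_mono mult_left_mono) auto
        also have "\<dots> \<le> C + 1" by (simp add: C_def)
        finally show "s * (real n * (2 * S.N * (B\<^sup>2 + \<sigma>\<^sup>2)) / real M +
          S.N * (LINT r|\<mu>. ((\<Sum>k=1..n. y k * e k r) - \<phi> r)\<^sup>2)) \<le> C + 1" .
      qed
      finally show ?thesis .
    qed
    moreover have "(projection_estimator e n M :: (nat \<Rightarrow> ((real^'d)^'n) \<times> ((real^'d)^'n)) \<Rightarrow> _) \<in> estimators \<mu> M"
      by (rule S.projection_estimator_in_estimators[unfolded \<mu>, where n=n]) (auto simp: e orth)
    ultimately show ?thesis
      by (intro INF_lower2[of "projection_estimator e n M"] SUP_least)
  qed
  then have "eventually (\<lambda>M. (INF est\<in>estimators \<mu> M. SUP \<phi>\<in>sobolev_class \<mu> \<psi> \<beta> L.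
      scaled_risk P X \<eta> \<mu> \<beta> M est \<phi>) \<le> ennreal (C + 1)) sequentially"
    by (auto simp: eventually_sequentially)
  then have "limsup (\<lambda>M. INF est\<in>estimators \<mu> M. SUP \<phi>\<in>sobolev_class \<mu> \<psi> \<beta> L.
      scaled_risk P X \<eta> \<mu> \<beta> M est \<phi>) \<le> ennreal (C + 1)"
    by (rule Limsup_bounded)
  then show ?thesis using C by (intro exI[of _ "C + 1"]) auto
qed

end
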